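(* Assume that $\Lambda$ is bounded. For any starting point $(x^0,\lambda^0)\in\mathcal X\times\Lambda$, let $C^{\mathrm P}_{\mathsf{det}}$ and $C^{\mathrm D}_{\mathsf{det}}$ denote the primal and dual oracle complexities of the deterministic IPDS algorithm (with the parameters and sub-problem solvers described in the context) to achieve an $\varepsilon$-duality gap, i.e. to produce $(x^{\rm out},\lambda^{\rm out})\in\mathcal X\times\Lambda$ with $\Delta(x^{\rm out},\lambda^{\rm out})\le\varepsilon$. Then $$C^{\mathrm P}_{\mathsf{det}}=O\Big(n\sqrt{\kappa_{\mathcal X}L_{\mathrm D}/\varepsilon}\;\log\big((L+L_{xx})L_{\mathrm D}/\varepsilon\big)\Big),$$ $$C^{\mathrm D}_{\mathsf{det}}=O\Big(n\big(\sqrt{L_{\lambda\lambda}L_{\mathrm D}}/\varepsilon\big)\log\big(L_{\lambda\lambda}L_{\mathrm D}/\varepsilon\big)\Big).$$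
   Context: Setting. $\mathbb E_1,\mathbb E_2$ are finite-dimensional real normed spaces (norms $\|\cdot\|$, dual norms $\|\cdot\|_*$, pairing $\langle\cdot,\cdot\rangle$). $\mathcal X\subseteq\mathbb E_1$, $\Lambda\subseteq\mathbb E_2$ are nonempty, closed, convex, $\mathcal X$ bounded. $f,g:\mathbb E_1\to\mathbb R\cup\{+\infty\}$, $h:\mathbb E_2\to\mathbb R\cup\{+\infty\}$ are convex, closed, proper, $\mathcal X\subseteq\mathrm{dom}\,g$, $\Lambda\subseteq\mathrm{dom}\,h$. $f$ is differentiable on an open set containing $\mathcal X$, and $\frac\mu2\|x-x'\|^2\le f(x)-f(x')-\langle\nabla f(x'),x-x'\rangle\le\frac L2\|x-x'\|^2$ for $x,x'\in\mathcal X$, with $L\ge\mu>0$. $\Phi=\frac1n\sum_{i=1}^n\Phi_i$ is real-valued on $\mathbb E_1\times\mathbb E_2$, each $\Phi_i$ is convex-concave and differentiable in each argument with Lipschitz partial gradients on $\mathcal X\times\Lambda$, and for all $x,x'\in\mathcal X$, $\lambda,\lambda'\in\Lambda$: $\|\nabla_x\Phi(x,\lambda)-\nabla_x\Phi(x',\lambda)\|_*\le L_{xx}\|x-x'\|$, $\|\nabla_x\Phi(x,\lambda)-\nabla_x\Phi(x,\lambda')\|_*\le L_{\lambda x}\|\lambda-\lambda'\|$, $\|\nabla_\lambda\Phi(x,\lambda)-\nabla_\lambda\Phi(x',\lambda)\|_*\le L_{\lambda x}\|x-x'\|$, $\|\nabla_\lambda\Phi(x,\lambda)-\nabla_\lambda\Phi(x,\lambda')\|_*\le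 L_{\lambda\lambda}\|\lambda-\lambda'\|$. The problem is $\min_{x\in\mathcal X}\max_{\lambda\in\Lambda}S(x,\lambda)$, $S(x,\lambda):=f(x)+g(x)+\Phi(x,\lambda)-h(\lambda)$; a saddle point exists. $\omega$ is a distance generating function (DGF) w.r.t. $(h,\Lambda)$: convex, closed, proper, $1$-strongly convex and continuous on $\Lambda$, essentially smooth, and such that for all $\alpha>0$, $\upsilon\in\mathbb E_2^*$ the problem $\min_{\lambda\in\Lambda}h(\lambda)+\langle\upsilon,\lambda\rangle+\alpha^{-1}\omega(\lambda)$ has a unique easily computable solution in $\Lambda^o:=\Lambda\cap\mathrm{int}\,\mathrm{dom}\,\omega$. Likewise $\overline\omega$ is a DGF w.r.t. $(g,\mathcal X)$ and $\mathcal X^o:=\mathcal X\cap\mathrm{int}\,\mathrm{dom}\,\overline\omega$. $L_{\mathrm D}:=L_{\lambda\lambda}+L_{\lambda x}^2/\mu$, $\kappa_{\mathcal X}:=(L+L_{xx})/\mu$, $B_{\omega,\Lambda}:=\sup_{\lambda\in\Lambda}|\omega(\lambda)|$. Definitions. $\widehat S^{\mathrm P}(x,\lambda):=f(x)+g(x)+\Phi(x,\lambda)$, $\widehat\psi^{\mathrm D}(\lambda):=\inf_{x\in\mathcal X}\widehat S^{\mathrm P}(x,\lambda)$, $\psi^{\mathrm D}:=\widehat\psi^{\mathrm D}-h$, $\psi^{\mathrm P}(x):=\sup_{\lambda\in\Lambda}S(x,\lambda)$, $\Delta(x,\lambda):=\psi^{\mathrm P}(x)-\psi^{\mathrm D}(\lambda)$.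 For $\rho>0$: $\widehat S^{\mathrm D}_\rho(x,\lambda):=\Phi(x,\lambda)-h(\lambda)-\rho\,\omega(\lambda)$, $\widehat\psi^{\mathrm P}_\rho(x):=\sup_{\lambda\in\Lambda}\widehat S^{\mathrm D}_\rho(x,\lambda)$. Oracles. On input $(x,\lambda,i)$, $i\in\{1,\dots,n\}$, the primal oracle returns $\nabla_x\Phi_i(x,\lambda)$ and the dual oracle returns $\nabla_\lambda\Phi_i(x,\lambda)$; on input $(x,0)$ the primal oracle returns $\nabla f(x)$. Primal (dual) oracle complexity is the number of calls to the primal (dual) oracle. Deterministic IPDS algorithm. Parameters: $\rho_0=8L_{\mathrm D}>0$, $\tau_k=\frac{k+1}{k+3}$, $\gamma_k=\eta_k=\frac{\varepsilon}{4(k+3)}$. For $k=0,1,\dots$: (1) find $\widetilde\lambda_{\rho_k,\eta_k}(x^k)\in\Lambda$ with $\widehat\psi^{\mathrm P}_{\rho_k}(x^k)-\widehat S^{\mathrm D}_{\rho_k}(x^k,\widetilde\lambda_{\rho_k,\eta_k}(x^k))\le\eta_k$; (2) $\hat\lambda^k=\tau_k\lambda^k+(1-\tau_k)\widetilde\lambda_{\rho_k,\eta_k}(x^k)$; (3) find $\widetilde x_{\gamma_k}(\hat\lambda^k)\in\mathcal X$ with $\widehat S^{\mathrm P}(\widetilde x_{\gamma_k}(\hat\lambda^k),\hat\lambda^k)-\widehat\psi^{\mathrm D}(\hat\lambda^k)\le\gamma_k$; (4) $x^{k+1}=\tau_kx^k+(1-\tau_k)\widetilde x_{\gamma_k}(\hat\lambda^k)$;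 (5) $\rho_{k+1}=\tau_k\rho_k$; (6) find $\widetilde\lambda_{\rho_{k+1},\eta_k}(x^{k+1})\in\Lambda$ with $\widehat\psi^{\mathrm P}_{\rho_{k+1}}(x^{k+1})-\widehat S^{\mathrm D}_{\rho_{k+1}}(x^{k+1},\widetilde\lambda_{\rho_{k+1},\eta_k}(x^{k+1}))\le\eta_k$; (7) $\lambda^{k+1}=\tau_k\lambda^k+(1-\tau_k)\widetilde\lambda_{\rho_{k+1},\eta_k}(x^{k+1})$. The output is the last iterate $(x^k,\lambda^k)$. Sub-problem solver. Steps (1), (3), (6) are solved by the accelerated proximal gradient method (APG). For $\min_{u\in\mathcal U}\Psi(u)=\phi_1(u)+\phi_2(u)$ with $\mathcal U$ convex compact, $\phi_1$ convex and $L'$-smooth on $\mathcal U$, $\Psi$ $\mu'$-strongly convex, $\phi_2$ convex with DGF $\pi$, $\kappa'=L'/\mu'$, minimizer $u^*$, the known guarantee of APG started from $u^0\in\mathcal U\cap\mathrm{int}\,\mathrm{dom}\,\pi$ is $\Psi(u^N)-\Psi(u^* )\le\frac{L'}4(1+1/\sqrt{2\kappa'})^{-2(N-1)}D_{\mathcal U,\pi}(u^0)$ for its $N$-th iterate, where $D_{\mathcal U,\pi}(u^0)=\max_{u\in\mathcal U}[\pi(u)-\pi(u^0)-\langle\nabla\pi(u^0),u-u^0\rangle]<\infty$; so an accuracy $e$ is reached after a pre-determined number $O(\sqrt{\kappa'}\log(L'/e))$ of iterations, each using one evaluation of $\nabla\phi_1$. In steps (1), (6), $\phi_1=-\Phi(x,\cdot)$,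 $L'=L_{\lambda\lambda}$, $\mu'=\rho$, each iteration costs $n$ dual oracle calls; in step (3), $\phi_1=f+\Phi(\cdot,\lambda)$, $L'=L+L_{xx}$, $\mu'=\mu$, each iteration costs $n+1$ primal oracle calls. Each run uses a fixed starting point in $\Lambda^o$ (resp. $\mathcal X^o$), and is run for the pre-determined number $O(\sqrt{\kappa'}\log(L'/e))$ of iterations prescribed by the APG guarantee $\Psi(u^N)-\Psi(u^* )\le\frac{L'}4(1+1/\sqrt{2\kappa'})^{-2(N-1)}D_{\mathcal U,\pi}(u^0)$ for reaching accuracy $e=\eta_k$ in steps (1), (6) and $e=\gamma_k$ in step (3). $O(\cdot)$ convention: $\varepsilon\to0$, i.e. bounds hold for all sufficiently small $\varepsilon>0$ (threshold depending on the other data); implied constants may depend on $B_{\omega,\Lambda}$ and on $\Delta(x^0,\lambda^0)$ relative to $L_{\mathrm D}$, but not on $\varepsilon,n,\kappa_{\mathcal X}$. For the dual bound, $L_{\lambda\lambda}>0$ is understood. *)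

theory Defs
  imports "HOL-Analysis.Analysis"
begin

section \<open>Convex analysis in a finite-dimensional normed space\<close>

text \<open>
  The spaces are types of class \<open>real_normed_vector\<close>, so the norm is arbitrary, with finite
  dimension stated separately. A dual vector is a bounded linear functional
  \<open>'u \<Rightarrow>\<^sub>L real\<close>; its library norm is the operator norm, i.e. the dual norm.
\<close>

definition finite_dim :: "'u::real_normed_vector itself \<Rightarrow> bool" where
  "finite_dim _ \<longleftrightarrow> (\<exists>B :: 'u set. finite B \<and> span B = UNIV)"

text \<open>Meaningful only where the function is differentiable (the derivative is then unique).\<close>

definition gradient :: "('u::real_normed_vector \<Rightarrow> real) \<Rightarrow> 'u \<Rightarrow> ('u \<Rightarrow>\<^sub>L real)" where
  "gradient \<phi> u = Blinfun (frechet_derivative \<phi> (at u))"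

definition edom :: "('u \<Rightarrow> ereal) \<Rightarrow> 'u set" where
  "edom \<phi> = {u. \<phi> u < \<infinity>}"

definition epi :: "('u \<Rightarrow> ereal) \<Rightarrow> ('u \<times> real) set" where
  "epi \<phi> = {(u, t). \<phi> u \<le> ereal t}"

definition convex_closed_proper :: "('u::real_normed_vector \<Rightarrow> ereal) \<Rightarrow> bool" where
  "convex_closed_proper \<phi> \<longleftrightarrow>
     convex (epi \<phi>) \<and> closed (epi \<phi>) \<and> (\<forall>u. \<phi> u \<noteq> -\<infinity>) \<and> edom \<phi> \<noteq> {}"

definition strongly_convex_on :: "'u::real_normed_vector set \<Rightarrow> real \<Rightarrow> ('u \<Rightarrow> ereal) \<Rightarrow> bool" where
  "strongly_convex_on U m \<phi> \<longleftrightarrow>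
     (\<forall>u\<in>U. \<forall>v\<in>U. \<forall>t\<in>{0..1}.
        \<phi> (t *\<^sub>R u + (1 - t) *\<^sub>R v)
          \<le> ereal t * \<phi> u + ereal (1 - t) * \<phi> v - ereal (m / 2 * t * (1 - t) * (norm (u - v))\<^sup>2))"

definition essentially_smooth :: "('u::real_normed_vector \<Rightarrow> ereal) \<Rightarrow> bool" where
  "essentially_smooth \<phi> \<longleftrightarrow>
     interior (edom \<phi>) \<noteq> {} \<and>
     (\<forall>u\<in>interior (edom \<phi>). (\<lambda>v. real_of_ereal (\<phi> v)) differentiable (at u)) \<and>
     (\<forall>s u. (\<forall>k. s k \<in> interior (edom \<phi>)) \<and> s \<longlonglongrightarrow> u \<and> u \<in> frontier (interior (edom \<phi>)) \<longrightarrow>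
        filterlim (\<lambda>k::nat. norm (gradient (\<lambda>v. real_of_ereal (\<phi> v)) (s k))) at_top sequentially)"

definition is_minimizer_on :: "'u set \<Rightarrow> ('u \<Rightarrow> ereal) \<Rightarrow> 'u \<Rightarrow> bool" where
  "is_minimizer_on U \<phi> u \<longleftrightarrow> u \<in> U \<and> (\<forall>v\<in>U. \<phi> u \<le> \<phi> v)"

text \<open>Distance generating function \<open>\<pi>\<close> with respect to \<open>(\<phi>, U)\<close>.\<close>

definition dgf :: "('u::real_normed_vector \<Rightarrow> ereal) \<Rightarrow> ('u \<Rightarrow> ereal) \<Rightarrow> 'u set \<Rightarrow> bool" where
  "dgf \<pi> \<phi> U \<longleftrightarrow>
     convex_closed_proper \<pi> \<and>
     U \<subseteq> edom \<pi> \<and> continuous_on U \<pi> \<and> strongly_convex_on U 1 \<pi> \<and>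
     essentially_smooth \<pi> \<and>
     (\<forall>\<alpha>>0. \<forall>\<upsilon> :: 'u \<Rightarrow>\<^sub>L real.
        let obj = (\<lambda>u. \<phi> u + ereal (blinfun_apply \<upsilon> u) + ereal (1 / \<alpha>) * \<pi> u)
        in (\<exists>!u. is_minimizer_on U obj u) \<and>
           (\<forall>u. is_minimizer_on U obj u \<longrightarrow> u \<in> U \<inter> interior (edom \<pi>)))"

text \<open>
  \<open>max_bregman U \<pi> u0\<close> is the number \<open>D\<^bsub>U,\<pi>\<^esub>(u0)\<close>. The real supremum is a true supremum in
  the cases of interest, where \<open>U\<close> is compact and \<open>\<pi>\<close> is continuous on \<open>U\<close>.
\<close>

definition max_bregman :: "'u::real_normed_vector set \<Rightarrow> ('u \<Rightarrow> ereal) \<Rightarrow> 'u \<Rightarrow> real" where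
  "max_bregman U \<pi> u0 =
     (SUP u\<in>U. real_of_ereal (\<pi> u) - real_of_ereal (\<pi> u0)
               - blinfun_apply (gradient (\<lambda>v. real_of_ereal (\<pi> v)) u0) (u - u0))"


section \<open>The saddle-point problem\<close>

record ('a, 'b) saddle_problem =
  Xset :: "'a set"
  Lset :: "'b set"
  f_part :: "'a \<Rightarrow> ereal"
  g_part :: "'a \<Rightarrow> ereal"
  h_part :: "'b \<Rightarrow> ereal"
  n_comp :: nat
  Phi_comp :: "nat \<Rightarrow> 'a \<Rightarrow> 'b \<Rightarrow> real"
  omega_D :: "'b \<Rightarrow> ereal"
  omega_P :: "'a \<Rightarrow> ereal"
  mu_f :: real
  L_f :: real
  L_xx :: real
  L_lx :: real
  L_ll :: real

definition f_real :: "('a, 'b) saddle_problem \<Rightarrow> 'a \<Rightarrow> real" where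
  "f_real P x = real_of_ereal (f_part P x)"

definition Phi :: "('a, 'b) saddle_problem \<Rightarrow> 'a \<Rightarrow> 'b \<Rightarrow> real" where
  "Phi P x l = (\<Sum>i = 1..n_comp P. Phi_comp P i x l) / real (n_comp P)"

definition Sfun :: "('a, 'b) saddle_problem \<Rightarrow> 'a \<Rightarrow> 'b \<Rightarrow> ereal" where
  "Sfun P x l = f_part P x + g_part P x + ereal (Phi P x l) - h_part P l"

definition grad_x :: "('a::real_normed_vector \<Rightarrow> 'b \<Rightarrow> real) \<Rightarrow> 'a \<Rightarrow> 'b \<Rightarrow> ('a \<Rightarrow>\<^sub>L real)" where
  "grad_x F x l = gradient (\<lambda>x'. F x' l) x"

definition grad_l :: "('a \<Rightarrow> 'b::real_normed_vector \<Rightarrow> real) \<Rightarrow> 'a \<Rightarrow> 'b \<Rightarrow> ('b \<Rightarrow>\<^sub>L real)" where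
  "grad_l F x l = gradient (\<lambda>l'. F x l') l"

definition LD :: "('a, 'b) saddle_problem \<Rightarrow> real" where
  "LD P = L_ll P + (L_lx P)\<^sup>2 / mu_f P"

definition kappa_X :: "('a, 'b) saddle_problem \<Rightarrow> real" where
  "kappa_X P = (L_f P + L_xx P) / mu_f P"

definition B_omega :: "('a, 'b) saddle_problem \<Rightarrow> real" where
  "B_omega P = (SUP l\<in>Lset P. \<bar>real_of_ereal (omega_D P l)\<bar>)"

text \<open>
  Convexity-concavity and differentiability of the \<open>\<Phi>\<^sub>i\<close> are required only at points of
  \<open>Xset \<times> Lset\<close>; the derivative at such a point is that of the function on the whole space.
\<close>

definition saddle_setting ::
    "('a::real_normed_vector, 'b::real_normed_vector) saddle_problem \<Rightarrow> bool" where
  "saddle_setting P \<longleftrightarrow>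
     finite_dim TYPE('a) \<and> finite_dim TYPE('b) \<and>
     Xset P \<noteq> {} \<and> closed (Xset P) \<and> convex (Xset P) \<and> bounded (Xset P) \<and>
     Lset P \<noteq> {} \<and> closed (Lset P) \<and> convex (Lset P) \<and>
     convex_closed_proper (f_part P) \<and> convex_closed_proper (g_part P) \<and> convex_closed_proper (h_part P) \<and>
     Xset P \<subseteq> edom (g_part P) \<and> Lset P \<subseteq> edom (h_part P) \<and>
     (\<exists>U. open U \<and> Xset P \<subseteq> U \<and> U \<subseteq> edom (f_part P) \<and> (\<forall>x\<in>U. f_real P differentiable (at x))) \<and>
     0 < mu_f P \<and> mu_f P \<le> L_f P \<and> 0 \<le> L_xx P \<and> 0 \<le> L_lx P \<and> 0 \<le> L_ll P \<and> 0 < LD P \<and>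
     (\<forall>x\<in>Xset P. \<forall>x'\<in>Xset P.
        mu_f P / 2 * (norm (x - x'))\<^sup>2
          \<le> f_real P x - f_real P x' - blinfun_apply (gradient (f_real P) x') (x - x') \<and>
        f_real P x - f_real P x' - blinfun_apply (gradient (f_real P) x') (x - x')
          \<le> L_f P / 2 * (norm (x - x'))\<^sup>2) \<and>
     1 \<le> n_comp P \<and>
     (\<forall>i\<in>{1..n_comp P}.
        (\<forall>l\<in>Lset P. convex_on (Xset P) (\<lambda>x. Phi_comp P i x l)) \<and>
        (\<forall>x\<in>Xset P. concave_on (Lset P) (\<lambda>l. Phi_comp P i x l)) \<and>
        (\<forall>x\<in>Xset P. \<forall>l\<in>Lset P. (\<lambda>x'. Phi_comp P i x' l) differentiable (at x) \<and>
                             (\<lambda>l'. Phi_comp P i x l') differentiable (at l)) \<and>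
        (\<exists>M. M-lipschitz_on (Xset P \<times> Lset P) (\<lambda>(x, l). grad_x (Phi_comp P i) x l)) \<and>
        (\<exists>M. M-lipschitz_on (Xset P \<times> Lset P) (\<lambda>(x, l). grad_l (Phi_comp P i) x l))) \<and>
     (\<forall>x\<in>Xset P. \<forall>x'\<in>Xset P. \<forall>l\<in>Lset P. \<forall>l'\<in>Lset P.
        norm (grad_x (Phi P) x l - grad_x (Phi P) x' l) \<le> L_xx P * norm (x - x') \<and>
        norm (grad_x (Phi P) x l - grad_x (Phi P) x l') \<le> L_lx P * norm (l - l') \<and>
        norm (grad_l (Phi P) x l - grad_l (Phi P) x' l) \<le> L_lx P * norm (x - x') \<and>
        norm (grad_l (Phi P) x l - grad_l (Phi P) x l') \<le> L_ll P * norm (l - l')) \<and>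
     (\<exists>x\<in>Xset P. \<exists>l\<in>Lset P. (\<forall>l'\<in>Lset P. Sfun P x l' \<le> Sfun P x l) \<and> (\<forall>x'\<in>Xset P. Sfun P x l \<le> Sfun P x' l)) \<and>
     dgf (omega_D P) (h_part P) (Lset P) \<and>
     dgf (omega_P P) (g_part P) (Xset P)"

definition SP_hat :: "('a, 'b) saddle_problem \<Rightarrow> 'a \<Rightarrow> 'b \<Rightarrow> ereal" where
  "SP_hat P x l = f_part P x + g_part P x + ereal (Phi P x l)"

definition psiD_hat :: "('a, 'b) saddle_problem \<Rightarrow> 'b \<Rightarrow> ereal" where
  "psiD_hat P l = (INF x\<in>Xset P. SP_hat P x l)"

definition psiD :: "('a, 'b) saddle_problem \<Rightarrow> 'b \<Rightarrow> ereal" where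
  "psiD P l = psiD_hat P l - h_part P l"

definition psiP :: "('a, 'b) saddle_problem \<Rightarrow> 'a \<Rightarrow> ereal" where
  "psiP P x = (SUP l\<in>Lset P. Sfun P x l)"

definition duality_gap :: "('a, 'b) saddle_problem \<Rightarrow> 'a \<Rightarrow> 'b \<Rightarrow> ereal" where
  "duality_gap P x l = psiP P x - psiD P l"

definition SD_hat :: "('a, 'b) saddle_problem \<Rightarrow> real \<Rightarrow> 'a \<Rightarrow> 'b \<Rightarrow> ereal" where
  "SD_hat P \<rho> x l = ereal (Phi P x l) - h_part P l - ereal \<rho> * omega_D P l"

definition psiP_hat :: "('a, 'b) saddle_problem \<Rightarrow> real \<Rightarrow> 'a \<Rightarrow> ereal" where
  "psiP_hat P \<rho> x = (SUP l\<in>Lset P. SD_hat P \<rho> x l)"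


section \<open>Programs with oracle calls\<close>

text \<open>
  An algorithm is a program whose only access to derivatives of \<open>f\<close> and \<open>\<Phi>\<^sub>i\<close> is through
  explicit oracle calls: \<open>Ask_primal q c\<close> submits \<open>q\<close> to the primal oracle and continues with
  \<open>c\<close> applied to the answer. \<open>Query_f x\<close> is the input \<open>(x, 0)\<close> of the primal oracle.
\<close>

datatype ('p, 'pa, 'd, 'da, 'r) oracle_prog =
    Return 'r
  | Ask_primal 'p "'pa \<Rightarrow> ('p, 'pa, 'd, 'da, 'r) oracle_prog"
  | Ask_dual 'd "'da \<Rightarrow> ('p, 'pa, 'd, 'da, 'r) oracle_prog"

primrec and_then :: "('p, 'pa, 'd, 'da, 'r) oracle_prog
    \<Rightarrow> ('r \<Rightarrow> ('p, 'pa, 'd, 'da, 's) oracle_prog) \<Rightarrow> ('p, 'pa, 'd, 'da, 's) oracle_prog"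
    (infixl "\<rhd>" 54) where
  "Return r \<rhd> k = k r"
| "Ask_primal q c \<rhd> k = Ask_primal q (\<lambda>a. c a \<rhd> k)"
| "Ask_dual q c \<rhd> k = Ask_dual q (\<lambda>a. c a \<rhd> k)"

datatype ('a, 'b) primal_query = Query_f 'a | Query_Phi 'a 'b nat

type_synonym ('a, 'b, 'r) prog =
  "(('a, 'b) primal_query, 'a \<Rightarrow>\<^sub>L real, 'a \<times> 'b \<times> nat, 'b \<Rightarrow>\<^sub>L real, 'r) oracle_prog"

fun primal_oracle :: "('a::real_normed_vector, 'b) saddle_problem
    \<Rightarrow> ('a, 'b) primal_query \<Rightarrow> ('a \<Rightarrow>\<^sub>L real)" where
  "primal_oracle P (Query_f x) = gradient (f_real P) x"
| "primal_oracle P (Query_Phi x l i) = grad_x (Phi_comp P i) x l"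

fun dual_oracle :: "('a, 'b::real_normed_vector) saddle_problem
    \<Rightarrow> 'a \<times> 'b \<times> nat \<Rightarrow> ('b \<Rightarrow>\<^sub>L real)" where
  "dual_oracle P (x, l, i) = grad_l (Phi_comp P i) x l"

primrec result :: "('a::real_normed_vector, 'b::real_normed_vector) saddle_problem
    \<Rightarrow> ('a, 'b, 'r) prog \<Rightarrow> 'r" where
  "result P (Return r) = r"
| "result P (Ask_primal q c) = result P (c (primal_oracle P q))"
| "result P (Ask_dual q c) = result P (c (dual_oracle P q))"

primrec primal_calls :: "('a::real_normed_vector, 'b::real_normed_vector) saddle_problem
    \<Rightarrow> ('a, 'b, 'r) prog \<Rightarrow> nat" where
  "primal_calls P (Return r) = 0"
| "primal_calls P (Ask_primal q c) = Suc (primal_calls P (c (primal_oracle P q)))"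
| "primal_calls P (Ask_dual q c) = primal_calls P (c (dual_oracle P q))"

primrec dual_calls :: "('a::real_normed_vector, 'b::real_normed_vector) saddle_problem
    \<Rightarrow> ('a, 'b, 'r) prog \<Rightarrow> nat" where
  "dual_calls P (Return r) = 0"
| "dual_calls P (Ask_primal q c) = dual_calls P (c (primal_oracle P q))"
| "dual_calls P (Ask_dual q c) = Suc (dual_calls P (c (dual_oracle P q)))"

primrec sum_grad_x :: "'a::real_normed_vector \<Rightarrow> 'b::real_normed_vector \<Rightarrow> nat
    \<Rightarrow> ('a, 'b, 'a \<Rightarrow>\<^sub>L real) prog" where
  "sum_grad_x x l 0 = Return 0"
| "sum_grad_x x l (Suc i) =
     sum_grad_x x l i \<rhd> (\<lambda>s. Ask_primal (Query_Phi x l (Suc i)) (\<lambda>a. Return (s + a)))"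

primrec sum_grad_l :: "'a::real_normed_vector \<Rightarrow> 'b::real_normed_vector \<Rightarrow> nat
    \<Rightarrow> ('a, 'b, 'b \<Rightarrow>\<^sub>L real) prog" where
  "sum_grad_l x l 0 = Return 0"
| "sum_grad_l x l (Suc i) =
     sum_grad_l x l i \<rhd> (\<lambda>s. Ask_dual (x, l, Suc i) (\<lambda>a. Return (s + a)))"

text \<open>
  The smooth parts \<open>\<phi>\<^sub>1\<close> of the two sub-problems: \<open>f + \<Phi>(\<cdot>, l)\<close>, whose gradient takes \<open>n + 1\<close>
  primal calls, and \<open>-\<Phi>(x, \<cdot>)\<close>, whose gradient takes \<open>n\<close> dual calls.
\<close>

definition smooth_P :: "('a, 'b) saddle_problem \<Rightarrow> 'b \<Rightarrow> 'a \<Rightarrow> real" where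
  "smooth_P P l x = f_real P x + Phi P x l"

definition smooth_D :: "('a, 'b) saddle_problem \<Rightarrow> 'a \<Rightarrow> 'b \<Rightarrow> real" where
  "smooth_D P x l = - Phi P x l"

definition eval_grad_P :: "nat \<Rightarrow> 'b::real_normed_vector \<Rightarrow> 'a::real_normed_vector
    \<Rightarrow> ('a, 'b, 'a \<Rightarrow>\<^sub>L real) prog" where
  "eval_grad_P n l x =
     Ask_primal (Query_f x) (\<lambda>a. sum_grad_x x l n \<rhd> (\<lambda>s. Return (a + s /\<^sub>R real n)))"

definition eval_grad_D :: "nat \<Rightarrow> 'a::real_normed_vector \<Rightarrow> 'b::real_normed_vector
    \<Rightarrow> ('a, 'b, 'b \<Rightarrow>\<^sub>L real) prog" where
  "eval_grad_D n x l = sum_grad_l x l n \<rhd> (\<lambda>s. Return (- (s /\<^sub>R real n)))"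


section \<open>The accelerated proximal gradient method as a sub-problem solver\<close>

text \<open>
  A deterministic method using one gradient of \<open>\<phi>\<^sub>1\<close> per iteration: from the starting point and
  the gradients received so far it determines the next point at which \<open>\<nabla>\<phi>\<^sub>1\<close> is evaluated, and
  its current iterate. The known data \<open>U\<close>, \<open>\<phi>\<^sub>2\<close>, \<open>\<pi>\<close>, \<open>L'\<close>, \<open>\<mu>'\<close> may be built into it.
\<close>

record (overloaded) 'u grad_method =
  next_query :: "'u \<Rightarrow> ('u \<Rightarrow>\<^sub>L real) list \<Rightarrow> 'u"
  iterate :: "'u \<Rightarrow> ('u \<Rightarrow>\<^sub>L real) list \<Rightarrow> 'u"

text \<open>The gradients received in the first \<open>N\<close> iterations, when they are given by \<open>G\<close>.\<close>

primrec history :: "'u::real_normed_vector grad_method \<Rightarrow> ('u \<Rightarrow> ('u \<Rightarrow>\<^sub>L real)) \<Rightarrow> 'u \<Rightarrow> nat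
    \<Rightarrow> ('u \<Rightarrow>\<^sub>L real) list" where
  "history M G u0 0 = []"
| "history M G u0 (Suc N) = history M G u0 N @ [G (next_query M u0 (history M G u0 N))]"

text \<open>
  The right-hand side of the guarantee for the \<open>N\<close>-th iterate, \<open>N \<ge> 1\<close>. When \<open>L' = 0\<close> it is \<open>0\<close>.
\<close>

definition apg_bound :: "real \<Rightarrow> real \<Rightarrow> real \<Rightarrow> nat \<Rightarrow> real" where
  "apg_bound L' \<mu>' D N = L' / 4 / (1 + 1 / sqrt (2 * (L' / \<mu>'))) ^ (2 * (N - 1)) * D"

definition apg_iterations :: "real \<Rightarrow> real \<Rightarrow> real \<Rightarrow> real \<Rightarrow> nat" where
  "apg_iterations L' \<mu>' D e = (LEAST N. 1 \<le> N \<and> apg_bound L' \<mu>' D N \<le> e)"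

text \<open>
  The guarantee on \<open>min\<^bsub>U\<^esub> \<phi>\<^sub>1 + \<phi>\<^sub>2\<close>. The method stays in \<open>U\<close>, as \<open>\<phi>\<^sub>1\<close> is only known to be smooth
  there.
\<close>

definition apg_guarantee :: "'u::real_normed_vector grad_method \<Rightarrow> 'u set
    \<Rightarrow> ('u \<Rightarrow> real) \<Rightarrow> ('u \<Rightarrow> ereal) \<Rightarrow> ('u \<Rightarrow> ereal) \<Rightarrow> real \<Rightarrow> real \<Rightarrow> bool" where
  "apg_guarantee M U \<phi>\<^sub>1 \<phi>\<^sub>2 \<pi> L' \<mu>' \<longleftrightarrow>
     (\<forall>u0 \<in> U \<inter> interior (edom \<pi>).
        (\<forall>N. next_query M u0 (history M (gradient \<phi>\<^sub>1) u0 N) \<in> U) \<and>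
        (\<forall>N\<ge>1. let u = iterate M u0 (history M (gradient \<phi>\<^sub>1) u0 N) in
           u \<in> U \<and>
           (ereal (\<phi>\<^sub>1 u) + \<phi>\<^sub>2 u) - (INF v\<in>U. ereal (\<phi>\<^sub>1 v) + \<phi>\<^sub>2 v)
             \<le> ereal (apg_bound L' \<mu>' (max_bregman U \<pi> u0) N)))"

text \<open>
  The non-smooth part \<open>h + \<rho> \<omega>\<close> of the dual sub-problem depends on \<open>\<rho>\<close>, hence so does the method.
\<close>

record (overloaded) ('a, 'b) solver =
  method_P :: "'a grad_method"
  method_D :: "real \<Rightarrow> 'b grad_method"
  start_P :: 'a
  start_D :: 'b

definition apg_solver :: "('a::real_normed_vector, 'b::real_normed_vector) saddle_problem
    \<Rightarrow> ('a, 'b) solver \<Rightarrow> bool" where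
  "apg_solver P A \<longleftrightarrow>
     start_P A \<in> Xset P \<inter> interior (edom (omega_P P)) \<and>
     start_D A \<in> Lset P \<inter> interior (edom (omega_D P)) \<and>
     (\<forall>l\<in>Lset P. apg_guarantee (method_P A) (Xset P) (smooth_P P l) (g_part P) (omega_P P)
                  (L_f P + L_xx P) (mu_f P)) \<and>
     (\<forall>\<rho>>0. \<forall>x\<in>Xset P. apg_guarantee (method_D A \<rho>) (Lset P) (smooth_D P x)
                  (\<lambda>l. h_part P l + ereal \<rho> * omega_D P l) (omega_D P) (L_ll P) \<rho>)"

primrec run_history :: "'u::real_normed_vector grad_method
    \<Rightarrow> ('u \<Rightarrow> ('a::real_normed_vector, 'b::real_normed_vector, 'u \<Rightarrow>\<^sub>L real) prog) \<Rightarrow> 'u \<Rightarrow> nat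
    \<Rightarrow> ('a, 'b, ('u \<Rightarrow>\<^sub>L real) list) prog" where
  "run_history M ev u0 0 = Return []"
| "run_history M ev u0 (Suc N) =
     run_history M ev u0 N \<rhd> (\<lambda>H. ev (next_query M u0 H) \<rhd> (\<lambda>a. Return (H @ [a])))"

definition run_method :: "'u::real_normed_vector grad_method
    \<Rightarrow> ('u \<Rightarrow> ('a::real_normed_vector, 'b::real_normed_vector, 'u \<Rightarrow>\<^sub>L real) prog) \<Rightarrow> 'u \<Rightarrow> nat
    \<Rightarrow> ('a, 'b, 'u) prog" where
  "run_method M ev u0 N = run_history M ev u0 N \<rhd> (\<lambda>H. Return (iterate M u0 H))"

definition solve_P :: "('a::real_normed_vector, 'b::real_normed_vector) saddle_problem
    \<Rightarrow> ('a, 'b) solver \<Rightarrow> real \<Rightarrow> 'b \<Rightarrow> ('a, 'b, 'a) prog" where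
  "solve_P P A \<gamma> l =
     run_method (method_P A) (eval_grad_P (n_comp P) l) (start_P A)
       (apg_iterations (L_f P + L_xx P) (mu_f P) (max_bregman (Xset P) (omega_P P) (start_P A)) \<gamma>)"

definition solve_D :: "('a::real_normed_vector, 'b::real_normed_vector) saddle_problem
    \<Rightarrow> ('a, 'b) solver \<Rightarrow> real \<Rightarrow> real \<Rightarrow> 'a \<Rightarrow> ('a, 'b, 'b) prog" where
  "solve_D P A \<rho> \<eta> x =
     run_method (method_D A \<rho>) (eval_grad_D (n_comp P) x) (start_D A)
       (apg_iterations (L_ll P) \<rho> (max_bregman (Lset P) (omega_D P) (start_D A)) \<eta>)"


section \<open>The deterministic IPDS algorithm\<close>

definition tau :: "nat \<Rightarrow> real" where
  "tau k = (real k + 1) / (real k + 3)"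

definition tol :: "real \<Rightarrow> nat \<Rightarrow> real" where
  "tol \<epsilon> k = \<epsilon> / (4 * (real k + 3))"

text \<open>The first \<open>k\<close> iterations, yielding \<open>(x\<^sup>k, \<lambda>\<^sup>k, \<rho>\<^sub>k)\<close>; \<open>tol \<epsilon> k\<close> is the common value of \<open>\<gamma>\<^sub>k\<close> and \<open>\<eta>\<^sub>k\<close>.\<close>

primrec ipds :: "('a::real_normed_vector, 'b::real_normed_vector) saddle_problem
    \<Rightarrow> ('a, 'b) solver \<Rightarrow> real \<Rightarrow> 'a \<Rightarrow> 'b \<Rightarrow> nat \<Rightarrow> ('a, 'b, 'a \<times> 'b \<times> real) prog" where
  "ipds P A \<epsilon> x0 l0 0 = Return (x0, l0, 8 * LD P)"
| "ipds P A \<epsilon> x0 l0 (Suc k) =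
     ipds P A \<epsilon> x0 l0 k \<rhd> (\<lambda>(x, l, \<rho>).
     solve_D P A \<rho> (tol \<epsilon> k) x \<rhd> (\<lambda>l1.
     let lhat = tau k *\<^sub>R l + (1 - tau k) *\<^sub>R l1 in
     solve_P P A (tol \<epsilon> k) lhat \<rhd> (\<lambda>x1.
     let x' = tau k *\<^sub>R x + (1 - tau k) *\<^sub>R x1;
         \<rho>' = tau k * \<rho> in
     solve_D P A \<rho>' (tol \<epsilon> k) x' \<rhd> (\<lambda>l2.
     Return (x', tau k *\<^sub>R l + (1 - tau k) *\<^sub>R l2, \<rho>')))))"

definition eps_gap_at :: "('a::real_normed_vector, 'b::real_normed_vector) saddle_problem
    \<Rightarrow> ('a, 'b) solver \<Rightarrow> real \<Rightarrow> 'a \<Rightarrow> 'b \<Rightarrow> nat \<Rightarrow> bool" where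
  "eps_gap_at P A \<epsilon> x0 l0 k \<longleftrightarrow>
     (case result P (ipds P A \<epsilon> x0 l0 k) of (x, l, \<rho>) \<Rightarrow>
        x \<in> Xset P \<and> l \<in> Lset P \<and> duality_gap P x l \<le> ereal \<epsilon>)"

text \<open>
  Oracle complexities: the calls made up to the first iterate that is an \<open>\<epsilon>\<close>-duality-gap
  solution, and \<open>\<infinity>\<close> if there is no such iterate.
\<close>

definition C_P_det :: "('a::real_normed_vector, 'b::real_normed_vector) saddle_problem
    \<Rightarrow> ('a, 'b) solver \<Rightarrow> 'a \<Rightarrow> 'b \<Rightarrow> real \<Rightarrow> enat" where
  "C_P_det P A x0 l0 \<epsilon> =
     (if \<exists>k. eps_gap_at P A \<epsilon> x0 l0 k
      then enat (primal_calls P (ipds P A \<epsilon> x0 l0 (LEAST k. eps_gap_at P A \<epsilon> x0 l0 k)))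
      else \<infinity>)"

definition C_D_det :: "('a::real_normed_vector, 'b::real_normed_vector) saddle_problem
    \<Rightarrow> ('a, 'b) solver \<Rightarrow> 'a \<Rightarrow> 'b \<Rightarrow> real \<Rightarrow> enat" where
  "C_D_det P A x0 l0 \<epsilon> =
     (if \<exists>k. eps_gap_at P A \<epsilon> x0 l0 k
      then enat (dual_calls P (ipds P A \<epsilon> x0 l0 (LEAST k. eps_gap_at P A \<epsilon> x0 l0 k)))
      else \<infinity>)"


section \<open>The solver meets the accuracy required of the sub-problems\<close>

text \<open>
  The final lemmas \<open>solve_P_accurate\<close> and \<open>solve_D_accurate\<close> say that the prescribed number of
  iterations yields points \<open>\<gamma>\<close>- and \<open>\<eta>\<close>-optimal in the sense required by the algorithm.
\<close>

lemma result_and_then: "result P (p \<rhd> k) = result P (k (result P p))"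
  by (induction p) auto

lemma calls_and_then:
  "primal_calls P (p \<rhd> k) = primal_calls P p + primal_calls P (k (result P p))"
  "dual_calls P (p \<rhd> k) = dual_calls P p + dual_calls P (k (result P p))"
  by (induction p) auto

lemma gradient_eqI:
  assumes "(\<phi> has_derivative blinfun_apply G) (at u)"
  shows "gradient \<phi> u = G"
  unfolding gradient_def frechet_derivative_at[OF assms, symmetric] by (rule blinfun_apply_inverse)

lemma gradient_works:
  fixes \<phi> :: "'u::real_normed_vector \<Rightarrow> real"
  assumes "\<phi> differentiable (at u)"
  shows "(\<phi> has_derivative blinfun_apply (gradient \<phi> u)) (at u)"
  using assms frechet_derivative_works[of \<phi> "at u"]
  by (auto simp: gradient_def bounded_linear_Blinfun_apply has_derivative_bounded_linear)

lemma sum_grad_x_result: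
  "result P (sum_grad_x x l m) = (\<Sum>i=1..m. grad_x (Phi_comp P i) x l)"
  by (induction m) (auto simp: result_and_then)

lemma sum_grad_l_result:
  "result P (sum_grad_l x l m) = (\<Sum>i=1..m. grad_l (Phi_comp P i) x l)"
  by (induction m) (auto simp: result_and_then)

lemma has_derivative_avg:
  assumes "\<And>i. i \<in> {1..n} \<Longrightarrow> (F i has_derivative blinfun_apply (G i)) (at u)"
  shows "((\<lambda>v. (\<Sum>i=1..n. F i v) / real n) has_derivative
            blinfun_apply ((\<Sum>i=1..n. G i) /\<^sub>R real n)) (at u)"
proof -
  have "((\<lambda>v. (\<Sum>i=1..n. F i v)) has_derivative (\<lambda>v. \<Sum>i=1..n. blinfun_apply (G i) v)) (at u)"
    by (rule has_derivative_sum) (use assms in auto)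
  from has_derivative_mult_right[OF this, of "inverse (real n)"]
  moreover have "blinfun_apply ((\<Sum>i=1..n. G i) /\<^sub>R real n) = (\<lambda>v. inverse (real n) * (\<Sum>i=1..n. blinfun_apply (G i) v))"
    by (auto simp: blinfun.bilinear_simps blinfun.sum_left)
  ultimately show ?thesis by (simp add: divide_inverse mult.commute)
qed

lemma eval_grad_D_result:
  assumes "saddle_setting P" "x \<in> Xset P" "l \<in> Lset P"
  shows "result P (eval_grad_D (n_comp P) x l) = gradient (smooth_D P x) l"
proof -
  have d: "\<And>i. i \<in> {1..n_comp P} \<Longrightarrow> (Phi_comp P i x has_derivative blinfun_apply (grad_l (Phi_comp P i) x l)) (at l)"
    using assms unfolding saddle_setting_def grad_l_def by (intro gradient_works) blast
  have "gradient (smooth_D P x) l = - ((\<Sum>i=1..n_comp P. grad_l (Phi_comp P i) x l) /\<^sub>R real (n_comp P))"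
    unfolding smooth_D_def Phi_def
    by (rule gradient_eqI) (use has_derivative_minus[OF has_derivative_avg[of "n_comp P" "\<lambda>i. Phi_comp P i x", OF d]] in \<open>simp add: uminus_blinfun.rep_eq\<close>)
  then show ?thesis by (simp add: eval_grad_D_def result_and_then sum_grad_l_result)
qed

lemma eval_grad_P_result:
  assumes "saddle_setting P" "x \<in> Xset P" "l \<in> Lset P"
  shows "result P (eval_grad_P (n_comp P) l x) = gradient (smooth_P P l) x"
proof -
  have d: "\<And>i. i \<in> {1..n_comp P} \<Longrightarrow> ((\<lambda>x. Phi_comp P i x l) has_derivative blinfun_apply (grad_x (Phi_comp P i) x l)) (at x)"
    using assms unfolding saddle_setting_def grad_x_def by (intro gradient_works) blast
  have e: "(f_real P has_derivative blinfun_apply (gradient (f_real P) x)) (at x)"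
    using assms unfolding saddle_setting_def by (intro gradient_works) blast
  have "gradient (smooth_P P l) x = gradient (f_real P) x + (\<Sum>i=1..n_comp P. grad_x (Phi_comp P i) x l) /\<^sub>R real (n_comp P)"
    unfolding smooth_P_def Phi_def
    by (rule gradient_eqI) (use has_derivative_add[OF e has_derivative_avg[of "n_comp P" "\<lambda>i x. Phi_comp P i x l", OF d]] in \<open>simp add: plus_blinfun.rep_eq\<close>)
  then show ?thesis by (simp add: eval_grad_P_def result_and_then sum_grad_x_result)
qed

lemma run_method_result:
  assumes "\<And>u. u \<in> U \<Longrightarrow> result P (ev u) = G u" "\<And>N. next_query M u0 (history M G u0 N) \<in> U"
  shows "result P (run_method M ev u0 N) = iterate M u0 (history M G u0 N)"
proof -
  have "result P (run_history M ev u0 N) = history M G u0 N" 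
    by (induction N) (auto simp: result_and_then assms)
  then show ?thesis by (simp add: run_method_def result_and_then)
qed

lemma apg_iterations_works:
  assumes "0 \<le> L'" "0 < m" "0 < e"
  shows "1 \<le> apg_iterations L' m D e \<and> apg_bound L' m D (apg_iterations L' m D e) \<le> e"
  unfolding apg_iterations_def
proof (rule LeastI_ex)
  show "\<exists>N\<ge>1. apg_bound L' m D N \<le> e"
  proof (cases "L' = 0 \<or> D \<le> 0")
    case True
    have "apg_bound L' m D 1 \<le> 0" using True assms by (auto simp: apg_bound_def mult_nonneg_nonpos)
    then show ?thesis using assms by (intro exI[of _ 1]) auto
  next
    case False
    define q where "q = 1 + 1 / sqrt (2 * (L' / m))"
    have q: "q > 1" using False assms by (auto simp: q_def)
    obtain j where j: "L' / 4 * D / e < q ^ j" using real_arch_pow[OF q] by blast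
    have "q ^ j \<le> q ^ (2*j)" using q by (intro power_increasing) auto
    with j have "L' / 4 * D / e < q ^ (2*j)" by linarith
    then have "L' / 4 * D / q ^ (2*j) \<le> e" using q assms False
      by (simp add: field_simps)
    then show ?thesis by (intro exI[of _ "Suc j"]) (auto simp: apg_bound_def q_def)
  qed
qed

lemma solve_P_accurate:
  assumes "saddle_setting P" "apg_solver P A" "l \<in> Lset P" "0 < \<gamma>"
  defines "xt \<equiv> result P (solve_P P A \<gamma> l)"
  shows "xt \<in> Xset P \<and> SP_hat P xt l - psiD_hat P l \<le> ereal \<gamma>"
proof -
  note S = assms(1)[unfolded saddle_setting_def]
  define N where "N = apg_iterations (L_f P + L_xx P) (mu_f P) (max_bregman (Xset P) (omega_P P) (start_P A)) \<gamma>"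
  have N: "1 \<le> N" "apg_bound (L_f P + L_xx P) (mu_f P) (max_bregman (Xset P) (omega_P P) (start_P A)) N \<le> \<gamma>"
    using apg_iterations_works[of "L_f P + L_xx P" "mu_f P" \<gamma>] S assms(4) unfolding N_def by auto
  have G: "apg_guarantee (method_P A) (Xset P) (smooth_P P l) (g_part P) (omega_P P) (L_f P + L_xx P) (mu_f P)"
    and st: "start_P A \<in> Xset P \<inter> interior (edom (omega_P P))"
    using assms(2,3) unfolding apg_solver_def by auto
  have xt: "xt = iterate (method_P A) (start_P A) (history (method_P A) (gradient (smooth_P P l)) (start_P A) N)"
    unfolding xt_def solve_P_def N_def
    by (rule run_method_result[where U="Xset P"])
       (use assms G st in \<open>auto simp: eval_grad_P_result apg_guarantee_def\<close>)
  have fr: "f_part P x = ereal (f_real P x)" if "x \<in> Xset P" for x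
  proof -
    have "f_part P x < \<infinity>" "f_part P x \<noteq> -\<infinity>" using S that by (auto simp: edom_def convex_closed_proper_def)
    then show ?thesis by (cases "f_part P x") (auto simp: f_real_def)
  qed
  have eq: "ereal (smooth_P P l x) + g_part P x = SP_hat P x l" if "x \<in> Xset P" for x
    using fr[OF that] by (cases "g_part P x") (auto simp: SP_hat_def smooth_P_def)
  have "xt \<in> Xset P \<and> (ereal (smooth_P P l xt) + g_part P xt) - (INF v\<in>Xset P. ereal (smooth_P P l v) + g_part P v) \<le> ereal (apg_bound (L_f P + L_xx P) (mu_f P) (max_bregman (Xset P) (omega_P P) (start_P A)) N)"
    using G st N(1) unfolding apg_guarantee_def Let_def xt by blast
  then have a: "xt \<in> Xset P" "SP_hat P xt l - psiD_hat P l \<le> ereal (apg_bound (L_f P + L_xx P) (mu_f P) (max_bregman (Xset P) (omega_P P) (start_P A)) N)"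
    by (auto simp: eq psiD_hat_def cong: INF_cong)
  then show ?thesis using N(2) by (meson ereal_less_eq(3) order_trans)
qed

lemma solve_D_accurate:
  assumes "saddle_setting P" "apg_solver P A" "x \<in> Xset P" "0 < \<rho>" "0 < \<eta>"
  defines "lt \<equiv> result P (solve_D P A \<rho> \<eta> x)"
  shows "lt \<in> Lset P \<and> psiP_hat P \<rho> x - SD_hat P \<rho> x lt \<le> ereal \<eta>"
proof -
  note S = assms(1)[unfolded saddle_setting_def]
  let ?D = "max_bregman (Lset P) (omega_D P) (start_D A)"
  define N where "N = apg_iterations (L_ll P) \<rho> ?D \<eta>"
  have N: "1 \<le> N" "apg_bound (L_ll P) \<rho> ?D N \<le> \<eta>"
    using apg_iterations_works[of "L_ll P" \<rho> \<eta>] S assms(4,5) unfolding N_def by auto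
  let ?p = "\<lambda>l. h_part P l + ereal \<rho> * omega_D P l"
  have G: "apg_guarantee (method_D A \<rho>) (Lset P) (smooth_D P x) ?p (omega_D P) (L_ll P) \<rho>"
    and st: "start_D A \<in> Lset P \<inter> interior (edom (omega_D P))"
    using assms(2,3,4) unfolding apg_solver_def by auto
  have lt: "lt = iterate (method_D A \<rho>) (start_D A) (history (method_D A \<rho>) (gradient (smooth_D P x)) (start_D A) N)"
    unfolding lt_def solve_D_def N_def
    by (rule run_method_result[where U="Lset P"])
       (use assms G st in \<open>auto simp: eval_grad_D_result apg_guarantee_def\<close>)
  have eq: "ereal (smooth_D P x l) + ?p l = - SD_hat P \<rho> x l" if "l \<in> Lset P" for l
  proof -
    have "h_part P l < \<infinity>" "h_part P l \<noteq> -\<infinity>" "omega_D P l < \<infinity>" "omega_D P l \<noteq> -\<infinity>"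
      using S that by (auto simp: edom_def convex_closed_proper_def dgf_def)
    then show ?thesis by (cases "h_part P l"; cases "omega_D P l") (auto simp: SD_hat_def smooth_D_def)
  qed
  have "lt \<in> Lset P \<and> (ereal (smooth_D P x lt) + ?p lt) - (INF v\<in>Lset P. ereal (smooth_D P x v) + ?p v) \<le> ereal (apg_bound (L_ll P) \<rho> ?D N)"
    using G st N(1) unfolding apg_guarantee_def Let_def lt by blast
  then have a: "lt \<in> Lset P" "- SD_hat P \<rho> x lt - (INF v\<in>Lset P. - SD_hat P \<rho> x v) \<le> ereal (apg_bound (L_ll P) \<rho> ?D N)"
    by (auto simp: eq cong: INF_cong)
  have "(INF v\<in>Lset P. - SD_hat P \<rho> x v) = - psiP_hat P \<rho> x"
    by (simp add: psiP_hat_def ereal_INF_uminus_eq)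
  with a(2) have "psiP_hat P \<rho> x - SD_hat P \<rho> x lt \<le> ereal (apg_bound (L_ll P) \<rho> ?D N)"
    by (simp add: minus_ereal_def add.commute)
  then show ?thesis using N(2) a(1) by (meson ereal_less_eq(3) order_trans)
qed

lemma eval_calls: 
  "primal_calls P (eval_grad_P n l x) = n + 1" "dual_calls P (eval_grad_P n l x) = 0"
  "primal_calls P (eval_grad_D n x l) = 0" "dual_calls P (eval_grad_D n x l) = n"
proof -
  have "primal_calls P (sum_grad_x x l n) = n" "dual_calls P (sum_grad_x x l n) = 0"
   "primal_calls P (sum_grad_l x l n) = 0" "dual_calls P (sum_grad_l x l n) = n"
    by (induction n) (auto simp: calls_and_then)
  then show "primal_calls P (eval_grad_P n l x) = n + 1" "dual_calls P (eval_grad_P n l x) = 0"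
  "primal_calls P (eval_grad_D n x l) = 0" "dual_calls P (eval_grad_D n x l) = n"
    by (auto simp: eval_grad_P_def eval_grad_D_def calls_and_then)
qed

end

theory Submission
  imports Defs
begin

text \<open>
  The method is an inexact excessive-gap scheme with one smoothing parameter. Replacing \<open>h\<close> by
  \<open>h + \<rho> \<omega>\<close> turns the duality gap \<open>\<Delta>(x, l)\<close> into the smoothed gap \<open>\<Delta>\<^sub>\<rho>(x, l)\<close>, from which it differs
  by at most \<open>\<rho> B\<close>, where \<open>B\<close> bounds \<open>\<bar>\<omega>\<bar>\<close> on the dual set. The heart of the proof is that one
  iteration with averaging weight \<open>\<tau>\<close> and accuracy \<open>e\<close> contracts the smoothed gap:
  \<open>\<Delta>\<^bsub>\<tau>\<rho>\<^esub>(x', l') \<le> \<tau> \<Delta>\<^sub>\<rho>(x, l) + 4 e\<close> (\<open>smoothed_gap_step\<close>). Two effects balance there. Moving from the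
  first dual point \<open>l1\<close> to the second one \<open>l2\<close> gains \<open>\<tau> \<rho> / 4 * \<parallel>l1 - l2\<parallel>\<^sup>2\<close>, because the smoothed dual
  objective is \<open>\<rho>\<close>-strongly concave; replacing the dual function by its linear model costs
  \<open>(1 - \<tau>)\<^sup>2 L\<^sub>D * \<parallel>l1 - l2\<parallel>\<^sup>2\<close>, because strong convexity in \<open>x\<close> makes the dual function smooth with
  a constant of order \<open>L\<^sub>D\<close> (\<open>dual_function_lower_model\<close>). The parameters are chosen so that the gain
  covers the cost.

  For \<open>\<tau>\<^sub>k = (k + 1) / (k + 3)\<close> the smoothing parameter is \<open>\<rho>\<^sub>k = 16 L\<^sub>D / ((k + 1) (k + 2))\<close>. Unrolling
  the contraction, the initial gap is damped by \<open>2 / ((k + 1) (k + 2))\<close> while the accumulated errors stay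
  below \<open>\<epsilon> / 2\<close>. With \<open>\<delta> = \<Delta>(x\<^sub>0, l\<^sub>0) / L\<^sub>D\<close> the gap is therefore at most \<open>\<epsilon>\<close> after
  \<open>K \<approx> sqrt ((4 \<delta> + 64 B) L\<^sub>D / \<epsilon>)\<close> iterations (\<open>eps_gap_at_large\<close>).

  It remains to count. One run of the inner solver takes at most
  \<open>2 + (1 + sqrt (2 \<kappa>')) / 2 * M\<close> steps, where \<open>exp M\<close> bounds the required reduction of the error
  (\<open>apg_iterations_le\<close>), and for small \<open>\<epsilon>\<close> one can take for \<open>M\<close> twice the logarithm of the theorem: that
  reduction grows only like \<open>\<epsilon> powr (- 3 / 2)\<close>, which is eventually below a constant times
  \<open>\<epsilon> powr (- 2)\<close>, so all remaining constants, such as the Bregman diameter, are absorbed. In the primal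
  sub-problem \<open>\<kappa>'\<close> is the fixed number \<open>\<kappa>\<^sub>X\<close>, which gives \<open>n K sqrt \<kappa>\<^sub>X\<close> times the logarithm. In the dual
  sub-problem \<open>sqrt \<kappa>'\<close> is \<open>sqrt (L\<^sub>l\<^sub>l / \<rho>\<^sub>k)\<close>, of order at most \<open>K sqrt (L\<^sub>l\<^sub>l / L\<^sub>D)\<close>, and
  \<open>n K\<^sup>2 sqrt (L\<^sub>l\<^sub>l / L\<^sub>D)\<close> is of order \<open>n sqrt (L\<^sub>l\<^sub>l L\<^sub>D) / \<epsilon>\<close>.

  Near-optimality of a point is always stated by comparing it with every competitor, so neither exact
  minimizers nor extended-real suprema occur in the argument. Finite dimension enters through
  compactness: the distance generating functions are bounded on the feasible sets, hence \<open>B\<close> is a true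
  supremum and the initial gap is finite.
\<close>

section \<open>Compactness in finite-dimensional normed spaces\<close>

text \<open>
  Bolzano-Weierstrass by induction on the spanning set. The induction hypothesis makes \<open>span B\<close>
  closed, so a new vector \<open>b\<close> has positive distance \<open>d\<close> from it; hence \<open>\<bar>c\<bar> * d \<le> \<parallel>c b + z\<parallel>\<close> for \<open>z\<close> in
  \<open>span B\<close>, and a bounded sequence has bounded \<open>b\<close>-coefficients.
\<close>

lemma bounded_seq_in_finite_span:
  fixes B :: "'u::real_normed_vector set"
  assumes "finite B" "\<And>n. s n \<in> span B" "\<And>n. norm (s n) \<le> C"
  shows "\<exists>l\<in>span B. \<exists>r :: nat \<Rightarrow> nat. strict_mono r \<and> (s \<circ> r) \<longlonglongrightarrow> l"
  using assms
proof (induction B arbitrary: s C rule: finite_induct)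
  case empty
  then have "s = (\<lambda>_. 0)" by auto
  then show ?case by (auto intro!: exI[of _ id] simp: strict_mono_id o_def)
next
  case (insert b B)
  show ?case
  proof (cases "b \<in> span B")
    case True
    then show ?thesis using insert.IH[of s C] insert.prems by (simp add: span_redundant)
  next
    case False
    have "closed (span B)"
      unfolding closed_sequential_limits
    proof (intro allI impI, elim conjE)
      fix t :: "nat \<Rightarrow> 'u" and l
      assume t: "\<forall>n. t n \<in> span B" "t \<longlonglongrightarrow> l"
      then have "Bseq t" by (simp add: convergent_imp_Bseq convergentI)
      then obtain K where "\<And>n. norm (t n) \<le> K" by (meson BseqE)
      then obtain l' r where l': "l' \<in> span B" "strict_mono r" "(t \<circ> r) \<longlonglongrightarrow> l'"
        using insert.IH[of t K, OF t(1)[rule_format]] by meson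
      have "(t \<circ> r) \<longlonglongrightarrow> l" using l'(2) t(2) by (rule LIMSEQ_subseq_LIMSEQ[rotated])
      with l' show "l \<in> span B" using LIMSEQ_unique by blast
    qed
    then have d: "0 < infdist b (span B)" (is "0 < ?d")
      using False by (intro infdist_pos_not_in_closed) (auto intro: span_zero)
    have "\<forall>n. \<exists>c. s n - c *\<^sub>R b \<in> span B" using insert.prems(1) by (simp add: span_breakdown_eq)
    then obtain c where c: "\<And>n. s n - c n *\<^sub>R b \<in> span B" by metis
    have cb: "\<bar>c n\<bar> * ?d \<le> C" for n
    proof (cases "c n = 0")
      case True
      then show ?thesis using order_trans[OF norm_ge_zero insert.prems(2)[of n]] by simp
    next
      case nz: False
      have "b - (1 / c n) *\<^sub>R s n = (- 1 / c n) *\<^sub>R (s n - c n *\<^sub>R b)"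
        using nz by (simp add: algebra_simps)
      moreover have "(- 1 / c n) *\<^sub>R (s n - c n *\<^sub>R b) \<in> span B" by (rule span_scale[OF c])
      ultimately have "b - (1 / c n) *\<^sub>R s n \<in> span B" by simp
      then have "?d \<le> dist b (b - (1 / c n) *\<^sub>R s n)" by (rule infdist_le)
      also have "\<dots> = norm (s n) / \<bar>c n\<bar>" by (simp add: dist_norm)
      finally show ?thesis using nz insert.prems(2)[of n] by (simp add: field_simps)
    qed
    have cb': "\<bar>c n\<bar> \<le> C / ?d" for n using cb[of n] d by (simp add: field_simps)
    then have "bounded (range c)" by (auto simp: bounded_real)
    then obtain k r where r: "strict_mono r" "(c \<circ> r) \<longlonglongrightarrow> k"
      using bounded_imp_convergent_subsequence by blast
    define w where "w n = s (r n) - c (r n) *\<^sub>R b" for n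
    have "norm (w n) \<le> C + C / ?d * norm b" for n
    proof -
      have "norm (w n) \<le> norm (s (r n)) + \<bar>c (r n)\<bar> * norm b"
        unfolding w_def by (rule order_trans[OF norm_triangle_ineq4]) simp
      also have "\<dots> \<le> C + C / ?d * norm b"
        by (intro add_mono mult_right_mono insert.prems(2) cb') auto
      finally show ?thesis .
    qed
    then have "\<exists>l\<in>span B. \<exists>q. strict_mono q \<and> (w \<circ> q) \<longlonglongrightarrow> l"
      using insert.IH[of w "C + C / ?d * norm b"] c unfolding w_def by blast
    then obtain l q where l: "l \<in> span B" "strict_mono q" "(w \<circ> q) \<longlonglongrightarrow> l"
      by blast
    have "(c \<circ> r \<circ> q) \<longlonglongrightarrow> k" using r(2) l(2) by (rule LIMSEQ_subseq_LIMSEQ)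
    then have "(\<lambda>n. (c \<circ> r \<circ> q) n *\<^sub>R b + (w \<circ> q) n) \<longlonglongrightarrow> k *\<^sub>R b + l"
      using l(3) by (intro tendsto_intros)
    then have "(s \<circ> (r \<circ> q)) \<longlonglongrightarrow> k *\<^sub>R b + l" by (simp add: o_def w_def)
    moreover have "k *\<^sub>R b + l \<in> span (insert b B)"
      using l(1) by (auto simp: span_breakdown_eq intro!: exI[of _ k])
    moreover have "strict_mono (r \<circ> q)" using r(1) l(2) by (rule strict_mono_o)
    ultimately show ?thesis by blast
  qed
qed

lemma finite_dim_bounded_closed_imp_compact:
  fixes S :: "'u::real_normed_vector set"
  assumes "finite_dim TYPE('u)" "bounded S" "closed S"
  shows "compact S"
  unfolding compact_def
proof (intro allI impI)
  fix s :: "nat \<Rightarrow> 'u" assume s: "\<forall>n. s n \<in> S"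
  obtain B :: "'u set" where B: "finite B" "span B = UNIV" using assms(1) by (auto simp: finite_dim_def)
  obtain C where "\<And>x. x \<in> S \<Longrightarrow> norm x \<le> C" using assms(2) by (auto simp: bounded_iff)
  with s obtain l r where "strict_mono r" "(s \<circ> r) \<longlonglongrightarrow> l"
    using bounded_seq_in_finite_span[OF B(1), of s C] B(2) by auto
  moreover have "l \<in> S"
    using closed_sequentially[OF assms(3), of "s \<circ> r" l] s calculation(2) by simp
  ultimately show "\<exists>l\<in>S. \<exists>r. strict_mono r \<and> (s \<circ> r) \<longlonglongrightarrow> l" by blast
qed

section \<open>Convexity, tangents and distance generating functions\<close>

lemma ereal_real_of_edom:
  assumes "convex_closed_proper \<phi>" "u \<in> edom \<phi>"
  shows "\<phi> u = ereal (real_of_ereal (\<phi> u))"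
  using assms by (cases "\<phi> u") (auto simp: convex_closed_proper_def edom_def)

lemma convex_on_real_of_ereal:
  assumes cp: "convex_closed_proper \<phi>" and U: "U \<subseteq> edom \<phi>" "convex U"
  shows "convex_on U (\<lambda>u. real_of_ereal (\<phi> u))"
  unfolding convex_on_def
proof (intro conjI U ballI allI impI)
  fix x y and s t :: real
  assume xy: "x \<in> U" "y \<in> U" and st: "0 \<le> s" "0 \<le> t" "s + t = 1"
  have ep: "(u, real_of_ereal (\<phi> u)) \<in> epi \<phi>" if "u \<in> U" for u
    using ereal_real_of_edom[OF cp, of u] U that by (auto simp: epi_def)
  have "s *\<^sub>R (x, real_of_ereal (\<phi> x)) + t *\<^sub>R (y, real_of_ereal (\<phi> y)) \<in> epi \<phi>"
    using cp ep[OF xy(1)] ep[OF xy(2)] st by (intro convexD) (auto simp: convex_closed_proper_def)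
  moreover have "s *\<^sub>R x + t *\<^sub>R y \<in> edom \<phi>" using convexD[OF U(2) xy st] U(1) by blast
  then have "\<phi> (s *\<^sub>R x + t *\<^sub>R y) = ereal (real_of_ereal (\<phi> (s *\<^sub>R x + t *\<^sub>R y)))"
    by (rule ereal_real_of_edom[OF cp])
  ultimately show "real_of_ereal (\<phi> (s *\<^sub>R x + t *\<^sub>R y)) \<le> s * real_of_ereal (\<phi> x) + t * real_of_ereal (\<phi> y)"
    by (simp add: epi_def) (metis ereal_less_eq(3))
qed

lemma convex_on_midpoint:
  assumes "convex_on U \<phi>" "u \<in> U" "v \<in> U"
  shows "\<phi> ((1 / 2) *\<^sub>R (u + v)) \<le> \<phi> u / 2 + \<phi> v / 2"
proof -
  have "\<forall>s\<ge>0. \<forall>t\<ge>0. s + t = 1 \<longrightarrow> \<phi> (s *\<^sub>R u + t *\<^sub>R v) \<le> s * \<phi> u + t * \<phi> v"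
    using assms unfolding convex_on_def by blast
  from this[rule_format, of "1 / 2" "1 / 2"]
  have "\<phi> ((1 / 2) *\<^sub>R u + (1 / 2) *\<^sub>R v) \<le> (1 / 2) * \<phi> u + (1 / 2) * \<phi> v" by simp
  then show ?thesis by (simp add: scaleR_add_right)
qed

lemma midpoint_in_convex:
  assumes "convex U" "u \<in> U" "v \<in> U"
  shows "(1 / 2) *\<^sub>R (u + v) \<in> U"
  using convexD[OF assms, of "1/2" "1/2"] by (simp add: scaleR_add_right)

text \<open>
  On an arbitrary convex set, where \<open>u\<close> may be a boundary point: the difference quotients along the
  segment from \<open>u\<close> to \<open>v\<close> are bounded by \<open>\<phi> v - \<phi> u\<close> and converge to the derivative in that direction.
\<close>

lemma convex_on_above_tangent:
  fixes \<phi> :: "'u::real_normed_vector \<Rightarrow> real"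
  assumes cv: "convex_on U \<phi>" and uv: "u \<in> U" "v \<in> U"
    and d: "(\<phi> has_derivative D) (at u)"
  shows "\<phi> u + D (v - u) \<le> \<phi> v"
proof -
  interpret D: bounded_linear D using d by (rule has_derivative_bounded_linear)
  have "((\<lambda>t. u + t *\<^sub>R (v - u)) has_derivative (\<lambda>t. t *\<^sub>R (v - u))) (at (0::real))"
    by (auto intro!: derivative_eq_intros)
  from has_derivative_compose[OF this] d
  have "((\<lambda>t. \<phi> (u + t *\<^sub>R (v - u))) has_derivative (\<lambda>t. D (t *\<^sub>R (v - u)))) (at (0::real))"
    by auto
  then have "((\<lambda>t. \<phi> (u + t *\<^sub>R (v - u))) has_real_derivative D (v - u)) (at 0)"
    unfolding has_field_derivative_def
    by (rule has_derivative_eq_rhs) (simp add: D.scaleR fun_eq_iff mult.commute)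
  then have "((\<lambda>t. (\<phi> (u + t *\<^sub>R (v - u)) - \<phi> u) / t) \<longlongrightarrow> D (v - u)) (at 0)"
    by (simp add: DERIV_def)
  then have lim: "((\<lambda>t. (\<phi> (u + t *\<^sub>R (v - u)) - \<phi> u) / t) \<longlongrightarrow> D (v - u)) (at_right 0)"
    by (rule filterlim_mono) (auto intro: at_le)
  have "eventually (\<lambda>t::real. t \<in> {0<..<1}) (at_right 0)"
    by (rule eventually_at_right_real) simp
  then have "eventually (\<lambda>t. (\<phi> (u + t *\<^sub>R (v - u)) - \<phi> u) / t \<le> \<phi> v - \<phi> u) (at_right 0)"
  proof (rule eventually_mono)
    fix t :: real assume t: "t \<in> {0<..<1}"
    have "\<phi> ((1 - t) *\<^sub>R u + t *\<^sub>R v) \<le> (1 - t) * \<phi> u + t * \<phi> v"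
      using cv uv t unfolding convex_on_def by auto
    moreover have "(1 - t) *\<^sub>R u + t *\<^sub>R v = u + t *\<^sub>R (v - u)" by (simp add: algebra_simps)
    ultimately have "\<phi> (u + t *\<^sub>R (v - u)) - \<phi> u \<le> (\<phi> v - \<phi> u) * t" by (simp add: algebra_simps)
    then show "(\<phi> (u + t *\<^sub>R (v - u)) - \<phi> u) / t \<le> \<phi> v - \<phi> u"
      using t by (simp add: pos_divide_le_eq)
  qed
  then have "D (v - u) \<le> \<phi> v - \<phi> u"
    by (rule tendsto_upperbound[OF lim]) simp
  then show ?thesis by simp
qed

lemma convex_on_average:
  assumes "\<And>i. i \<in> {1..n} \<Longrightarrow> convex_on S (F i)" "convex S"
  shows "convex_on S (\<lambda>x. (\<Sum>i=1..n. F i x) / real n)"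
  unfolding convex_on_def
proof (intro conjI assms(2) ballI allI impI)
  fix x y and s t :: real
  assume xy: "x \<in> S" "y \<in> S" and st: "0 \<le> s" "0 \<le> t" "s + t = 1"
  have "(\<Sum>i=1..n. F i (s *\<^sub>R x + t *\<^sub>R y)) \<le> (\<Sum>i=1..n. s * F i x + t * F i y)"
    using assms(1) xy st unfolding convex_on_def by (intro sum_mono) blast
  then have "(\<Sum>i=1..n. F i (s *\<^sub>R x + t *\<^sub>R y)) / real n \<le> (\<Sum>i=1..n. s * F i x + t * F i y) / real n"
    by (rule divide_right_mono) simp
  also have "\<dots> = s * ((\<Sum>i=1..n. F i x) / real n) + t * ((\<Sum>i=1..n. F i y) / real n)"
    by (simp add: sum.distrib sum_distrib_left add_divide_distrib)
  finally show "(\<Sum>i=1..n. F i (s *\<^sub>R x + t *\<^sub>R y)) / real n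
      \<le> s * ((\<Sum>i=1..n. F i x) / real n) + t * ((\<Sum>i=1..n. F i y) / real n)" .
qed

lemma blinfun_diff_le:
  assumes "norm (G - H) \<le> c"
  shows "blinfun_apply G z \<le> blinfun_apply H z + c * norm z"
proof -
  have "blinfun_apply (G - H) z \<le> norm (blinfun_apply (G - H) z)" by simp
  also have "\<dots> \<le> norm (G - H) * norm z" by (rule norm_blinfun)
  also have "\<dots> \<le> c * norm z" using assms by (rule mult_right_mono) simp
  finally show ?thesis by (simp add: blinfun.diff_left)
qed

lemma dgf_bounded_on:
  fixes U :: "'u::real_normed_vector set"
  assumes fd: "finite_dim TYPE('u)" and U: "U \<noteq> {}" "closed U" "bounded U" and dgf: "dgf \<pi> \<phi> U"
  shows "\<exists>K. \<forall>u\<in>U. \<bar>real_of_ereal (\<pi> u)\<bar> \<le> K"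
proof -
  have cp: "convex_closed_proper \<pi>" "U \<subseteq> edom \<pi>" "continuous_on U \<pi>"
    using dgf by (auto simp: dgf_def)
  have co: "compact U" using fd U by (simp add: finite_dim_bounded_closed_imp_compact)
  obtain a where a: "a \<in> U" "\<And>u. u \<in> U \<Longrightarrow> \<pi> u \<le> \<pi> a"
    using continuous_attains_sup[OF co U(1) cp(3)] by blast
  obtain b where b: "b \<in> U" "\<And>u. u \<in> U \<Longrightarrow> \<pi> b \<le> \<pi> u"
    using continuous_attains_inf[OF co U(1) cp(3)] by blast
  have fin: "\<pi> u = ereal (real_of_ereal (\<pi> u))" if "u \<in> U" for u
    using ereal_real_of_edom[OF cp(1)] that cp(2) by blast
  have "\<bar>real_of_ereal (\<pi> u)\<bar> \<le> \<bar>real_of_ereal (\<pi> a)\<bar> + \<bar>real_of_ereal (\<pi> b)\<bar>" if "u \<in> U" for u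
  proof -
    have "real_of_ereal (\<pi> u) \<le> real_of_ereal (\<pi> a)"
      using a(2)[OF that] fin[OF that] fin[OF a(1)] by (metis ereal_less_eq(3))
    moreover have "real_of_ereal (\<pi> b) \<le> real_of_ereal (\<pi> u)"
      using b(2)[OF that] fin[OF that] fin[OF b(1)] by (metis ereal_less_eq(3))
    ultimately show ?thesis by linarith
  qed
  then show ?thesis by blast
qed

text \<open>
  The problem \<open>min \<phi> + \<upsilon> + \<pi>\<close> is solvable by the definition of a distance generating function, and \<open>\<pi>\<close>
  is bounded on \<open>U\<close>. The bound yields the finiteness of the duality gap.
\<close>

lemma dgf_linear_lower_bound:
  fixes U :: "'u::real_normed_vector set"
  assumes fd: "finite_dim TYPE('u)" and U: "U \<noteq> {}" "closed U" "bounded U" and dgf: "dgf \<pi> \<phi> U"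
    and phi: "convex_closed_proper \<phi>" "U \<subseteq> edom \<phi>"
  shows "\<exists>c. \<forall>u\<in>U. c \<le> real_of_ereal (\<phi> u) + blinfun_apply \<upsilon> u"
proof -
  obtain K where K: "\<And>u. u \<in> U \<Longrightarrow> \<bar>real_of_ereal (\<pi> u)\<bar> \<le> K"
    using dgf_bounded_on[OF fd U dgf] by blast
  have cp: "convex_closed_proper \<pi>" "U \<subseteq> edom \<pi>" using dgf by (auto simp: dgf_def)
  define obj where "obj u = \<phi> u + ereal (blinfun_apply \<upsilon> u) + ereal (1 / 1) * \<pi> u" for u
  have "\<exists>!u. is_minimizer_on U obj u"
  proof -
    have "\<forall>\<alpha>>0. \<forall>\<upsilon>. \<exists>!u. is_minimizer_on U (\<lambda>u. \<phi> u + ereal (blinfun_apply \<upsilon> u) + ereal (1 / \<alpha>) * \<pi> u) u"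
      using dgf unfolding dgf_def Let_def by blast
    then show ?thesis unfolding obj_def by (rule allE[of _ 1]) simp
  qed
  then obtain m where m: "m \<in> U" "\<And>u. u \<in> U \<Longrightarrow> obj m \<le> obj u"
    unfolding is_minimizer_on_def by blast
  have obj: "obj u = ereal (real_of_ereal (\<phi> u) + blinfun_apply \<upsilon> u + real_of_ereal (\<pi> u))" if "u \<in> U" for u
  proof -
    have "\<phi> u = ereal (real_of_ereal (\<phi> u))" "\<pi> u = ereal (real_of_ereal (\<pi> u))"
      using that phi cp ereal_real_of_edom by blast+
    then show ?thesis unfolding obj_def by (metis div_by_1 mult_1 one_ereal_def plus_ereal.simps(1))
  qed
  have "real_of_ereal (\<phi> m) + blinfun_apply \<upsilon> m + real_of_ereal (\<pi> m) - K
          \<le> real_of_ereal (\<phi> u) + blinfun_apply \<upsilon> u" if "u \<in> U" for u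
    using m(2)[OF that] abs_le_D1[OF K[OF that]] unfolding obj[OF that] obj[OF m(1)] ereal_less_eq by linarith
  then show ?thesis by blast
qed

section \<open>Iteration count of the accelerated method\<close>

text \<open>
  The guarantee contracts by \<open>(1 + 1 / s) ^ 2\<close> per step with \<open>s = sqrt (2 * (L' / m))\<close>, and
  \<open>ln (1 + 1 / s) \<ge> 1 / (1 + s)\<close> for every \<open>s > 0\<close>. The summand \<open>1\<close> in \<open>1 + s\<close> matters when \<open>L' / m\<close> is
  small, as in the first dual sub-problems, where \<open>m\<close> is large.
\<close>

lemma apg_iterations_le:
  assumes pos: "0 < L'" "0 < m" "0 < e" "0 \<le> M" and M: "L' / 4 * D \<le> e * exp M"
  shows "real (apg_iterations L' m D e) \<le> 2 + (1 + sqrt (2 * (L' / m))) / 2 * M"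
proof -
  define s where "s = sqrt (2 * (L' / m))"
  have s: "0 < s" using pos by (simp add: s_def)
  define j where "j = nat \<lceil>(1 + s) / 2 * M\<rceil>"
  have j: "(1 + s) / 2 * M \<le> real j" "real j \<le> (1 + s) / 2 * M + 1"
    using s pos(4) by (auto simp: j_def)
  have "(1 / s) / (1 + 1 / s) \<le> ln (1 / s + 1)" using s by (intro ln_add1_ge) simp
  then have ln: "1 / (1 + s) \<le> ln (1 + 1 / s)" using s by (simp add: field_simps)
  have "M = (2 / (1 + s)) * ((1 + s) / 2 * M)" using s by simp
  also have "\<dots> \<le> (2 / (1 + s)) * real j" using j(1) s by (intro mult_left_mono) auto
  also have "\<dots> = real (2 * j) * (1 / (1 + s))" by simp
  also have "\<dots> \<le> real (2 * j) * ln (1 + 1 / s)" using ln by (intro mult_left_mono) auto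
  finally have "exp M \<le> exp (real (2 * j) * ln (1 + 1 / s))" by simp
  also have "\<dots> = (1 + 1 / s) ^ (2 * j)" using s by (subst exp_of_nat_mult) (simp add: add_pos_pos)
  finally have q: "exp M \<le> (1 + 1 / s) ^ (2 * j)" .
  have "L' / 4 * D \<le> e * (1 + 1 / s) ^ (2 * j)"
    using M mult_left_mono[OF q, of e] pos(3) by linarith
  then have "apg_bound L' m D (Suc j) \<le> e"
    using s unfolding apg_bound_def s_def[symmetric] by (simp add: field_simps add_pos_pos)
  then have "apg_iterations L' m D e \<le> Suc j" unfolding apg_iterations_def by (intro Least_le) auto
  then show ?thesis using j(2) by (simp add: s_def)
qed

section \<open>The saddle-point problem in real-valued form\<close>

locale saddle_point =
  fixes P :: "('a::real_normed_vector, 'b::real_normed_vector) saddle_problem"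
  assumes setting: "saddle_setting P"
begin

abbreviation "X \<equiv> Xset P"
abbreviation "Y \<equiv> Lset P"

definition primal :: "'a \<Rightarrow> 'b \<Rightarrow> real" where
  "primal x l = f_real P x + real_of_ereal (g_part P x) + Phi P x l"

definition h :: "'b \<Rightarrow> real" where
  "h l = real_of_ereal (h_part P l)"

definition omega :: "'b \<Rightarrow> real" where
  "omega l = real_of_ereal (omega_D P l)"

definition smoothed_dual :: "real \<Rightarrow> 'a \<Rightarrow> 'b \<Rightarrow> real" where
  "smoothed_dual \<rho> x l = Phi P x l - h l - \<rho> * omega l"

lemma convex_X: "convex X" and convex_Y: "convex Y"
  and X_nonempty: "X \<noteq> {}" and Y_nonempty: "Y \<noteq> {}"
  and closed_X: "closed X" and closed_Y: "closed Y" and bounded_X: "bounded X"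
  and finite_dim_X: "finite_dim TYPE('a)" and finite_dim_Y: "finite_dim TYPE('b)"
  and mu_pos: "0 < mu_f P" and mu_le_L: "mu_f P \<le> L_f P"
  and L_xx_nonneg: "0 \<le> L_xx P"
  and LD_pos: "0 < LD P" and n_pos: "1 \<le> n_comp P"
  and dgf_D: "dgf (omega_D P) (h_part P) Y" and dgf_P: "dgf (omega_P P) (g_part P) X"
  and ccp_f: "convex_closed_proper (f_part P)" and ccp_g: "convex_closed_proper (g_part P)"
  and ccp_h: "convex_closed_proper (h_part P)"
  and X_dom_g: "X \<subseteq> edom (g_part P)" and Y_dom_h: "Y \<subseteq> edom (h_part P)"
  and X_dom_f: "X \<subseteq> edom (f_part P)"
  using setting unfolding saddle_setting_def by (blast+)

lemma ccp_omega_D: "convex_closed_proper (omega_D P)" and Y_dom_omega_D: "Y \<subseteq> edom (omega_D P)"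
  using dgf_D by (auto simp: dgf_def)

lemma f_part_eq: "x \<in> X \<Longrightarrow> f_part P x = ereal (f_real P x)"
  using ereal_real_of_edom[OF ccp_f] X_dom_f by (auto simp: f_real_def)

lemma g_part_eq: "x \<in> X \<Longrightarrow> g_part P x = ereal (real_of_ereal (g_part P x))"
  using ereal_real_of_edom[OF ccp_g] X_dom_g by auto

lemma h_part_eq: "l \<in> Y \<Longrightarrow> h_part P l = ereal (h l)"
  using ereal_real_of_edom[OF ccp_h] Y_dom_h by (auto simp: h_def)

lemma omega_D_eq: "l \<in> Y \<Longrightarrow> omega_D P l = ereal (omega l)"
  using ereal_real_of_edom[OF ccp_omega_D] Y_dom_omega_D by (auto simp: omega_def)

lemma SP_hat_eq: "x \<in> X \<Longrightarrow> SP_hat P x l = ereal (primal x l)"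
  unfolding SP_hat_def primal_def using f_part_eq g_part_eq by (metis plus_ereal.simps(1))

lemma Sfun_eq: "x \<in> X \<Longrightarrow> l \<in> Y \<Longrightarrow> Sfun P x l = ereal (primal x l - h l)"
  using SP_hat_eq[of x l] by (simp add: Sfun_def SP_hat_def h_part_eq)

lemma SD_hat_eq: "l \<in> Y \<Longrightarrow> SD_hat P \<rho> x l = ereal (smoothed_dual \<rho> x l)"
  by (simp add: SD_hat_def smoothed_dual_def h_part_eq omega_D_eq)

lemma f_derivative: "x \<in> X \<Longrightarrow> (f_real P has_derivative blinfun_apply (gradient (f_real P) x)) (at x)"
  using setting unfolding saddle_setting_def by (intro gradient_works) blast

lemma Phi_derivative_x:
  assumes "x \<in> X" "l \<in> Y"
  shows "((\<lambda>x. Phi P x l) has_derivative blinfun_apply (grad_x (Phi P) x l)) (at x)"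
proof -
  have "\<And>i. i \<in> {1..n_comp P} \<Longrightarrow>
      ((\<lambda>x. Phi_comp P i x l) has_derivative blinfun_apply (grad_x (Phi_comp P i) x l)) (at x)"
    using setting assms unfolding saddle_setting_def grad_x_def by (intro gradient_works) blast
  from has_derivative_avg[of "n_comp P" "\<lambda>i x. Phi_comp P i x l", OF this]
  have "(\<lambda>x. Phi P x l) differentiable (at x)" unfolding Phi_def differentiable_def by blast
  then show ?thesis unfolding grad_x_def by (rule gradient_works)
qed

lemma Phi_derivative_l:
  assumes "x \<in> X" "l \<in> Y"
  shows "(Phi P x has_derivative blinfun_apply (grad_l (Phi P) x l)) (at l)"
proof -
  have "\<And>i. i \<in> {1..n_comp P} \<Longrightarrow>
      (Phi_comp P i x has_derivative blinfun_apply (grad_l (Phi_comp P i) x l)) (at l)"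
    using setting assms unfolding saddle_setting_def grad_l_def by (intro gradient_works) blast
  from has_derivative_avg[of "n_comp P" "\<lambda>i. Phi_comp P i x", OF this]
  have "(\<lambda>l. Phi P x l) differentiable (at l)" unfolding Phi_def differentiable_def by blast
  then show ?thesis unfolding grad_l_def by (intro gradient_works) simp
qed

lemma Phi_convex: "l \<in> Y \<Longrightarrow> convex_on X (\<lambda>x. Phi P x l)"
  unfolding Phi_def using setting unfolding saddle_setting_def
  by (intro convex_on_average convex_X) blast

lemma Phi_concave: 
  assumes "x \<in> X" 
  shows "convex_on Y (\<lambda>l. - Phi P x l)"
proof -
  have "convex_on Y (\<lambda>l. (\<Sum>i=1..n_comp P. - Phi_comp P i x l) / real (n_comp P))"
    using setting assms unfolding saddle_setting_def concave_on_def
    by (intro convex_on_average convex_Y) blast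
  then show ?thesis by (simp add: Phi_def sum_negf)
qed

lemma f_convex: "convex_on X (f_real P)"
  using convex_on_real_of_ereal[OF ccp_f X_dom_f convex_X] by (simp add: f_real_def[abs_def])

lemma h_convex: "convex_on Y h"
  using convex_on_real_of_ereal[OF ccp_h Y_dom_h convex_Y] by (simp add: h_def[abs_def])

lemma primal_convex: "l \<in> Y \<Longrightarrow> convex_on X (\<lambda>x. primal x l)"
  unfolding primal_def
  by (intro convex_on_add f_convex Phi_convex convex_on_real_of_ereal ccp_g X_dom_g convex_X)

text \<open>
  Strong convexity is needed only at midpoints: compared with the midpoint of itself and a competitor, a
  near-minimizer still gains a quadratic term.
\<close>

lemma primal_midpoint:
  assumes "x \<in> X" "y \<in> X" "l \<in> Y"
  shows "primal ((1 / 2) *\<^sub>R (x + y)) l \<le> primal x l / 2 + primal y l / 2 - mu_f P / 8 * (norm (x - y))\<^sup>2"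
proof -
  define m where "m = (1 / 2) *\<^sub>R (x + y)"
  have m: "m \<in> X" unfolding m_def using assms by (intro midpoint_in_convex convex_X)
  have e: "x - m = (1 / 2) *\<^sub>R (x - y)" "y - m = - ((1 / 2) *\<^sub>R (x - y))"
    by (simp_all add: m_def algebra_simps) (simp_all flip: scaleR_add_left)
  have f: "mu_f P / 2 * (norm (z - m))\<^sup>2 \<le> f_real P z - f_real P m - blinfun_apply (gradient (f_real P) m) (z - m)"
    if "z \<in> X" for z
    using setting that m unfolding saddle_setting_def by blast
  have "f_real P m \<le> f_real P x / 2 + f_real P y / 2 - mu_f P / 8 * (norm (x - y))\<^sup>2"
    using f[OF assms(1)] f[OF assms(2)] unfolding e
    by (simp add: blinfun.minus_right power_mult_distrib power_divide)
  moreover have "real_of_ereal (g_part P m) + Phi P m l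
      \<le> (real_of_ereal (g_part P x) + Phi P x l) / 2 + (real_of_ereal (g_part P y) + Phi P y l) / 2"
    unfolding m_def using assms
    by (intro convex_on_midpoint[of X "\<lambda>x. real_of_ereal (g_part P x) + Phi P x l"] convex_on_add
        Phi_convex convex_on_real_of_ereal ccp_g X_dom_g convex_X)
  ultimately show ?thesis unfolding primal_def m_def[symmetric] by (simp add: add_divide_distrib)
qed

lemma smoothed_dual_midpoint:
  assumes "x \<in> X" "l \<in> Y" "v \<in> Y" "0 < \<rho>"
  shows "smoothed_dual \<rho> x l / 2 + smoothed_dual \<rho> x v / 2 + \<rho> / 8 * (norm (l - v))\<^sup>2
           \<le> smoothed_dual \<rho> x ((1 / 2) *\<^sub>R (l + v))"
proof -
  define m where "m = (1 / 2) *\<^sub>R (l + v)"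
  have m: "m \<in> Y" unfolding m_def using assms by (intro midpoint_in_convex convex_Y)
  have m': "(1 / 2) *\<^sub>R l + (1 - 1 / 2) *\<^sub>R v = m" by (simp add: m_def scaleR_add_right)
  have "strongly_convex_on Y 1 (omega_D P)" using dgf_D by (simp add: dgf_def)
  moreover have "1 / 2 \<in> {0..1::real}" by simp
  ultimately have "omega_D P ((1 / 2) *\<^sub>R l + (1 - 1 / 2) *\<^sub>R v)
      \<le> ereal (1 / 2) * omega_D P l + ereal (1 - 1 / 2) * omega_D P v
         - ereal (1 / 2 * (1 / 2) * (1 - 1 / 2) * (norm (l - v))\<^sup>2)"
    using assms(2,3) unfolding strongly_convex_on_def by blast
  then have "omega m \<le> omega l / 2 + omega v / 2 - 1 / 8 * (norm (l - v))\<^sup>2"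
    using assms m unfolding m' by (simp add: omega_D_eq)
  then have "\<rho> * omega m \<le> \<rho> * (omega l / 2 + omega v / 2 - 1 / 8 * (norm (l - v))\<^sup>2)"
    using assms(4) by (intro mult_left_mono) auto
  moreover have "- Phi P x m + h m \<le> (- Phi P x l + h l) / 2 + (- Phi P x v + h v) / 2"
    unfolding m_def using assms
    by (intro convex_on_midpoint[of Y "\<lambda>l. - Phi P x l + h l"] convex_on_add Phi_concave h_convex)
  ultimately show ?thesis
    unfolding smoothed_dual_def m_def[symmetric] by (simp add: algebra_simps add_divide_distrib diff_divide_distrib)
qed

lemma Phi_below_tangent:
  assumes "x \<in> X" "l \<in> Y" "v \<in> Y"
  shows "Phi P x v \<le> Phi P x l + blinfun_apply (grad_l (Phi P) x l) (v - l)"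
  using convex_on_above_tangent[OF Phi_concave[OF assms(1)] assms(2,3)
      has_derivative_minus[OF Phi_derivative_l[OF assms(1,2)]]] by simp

text \<open>
  The tangent inequality at \<open>v\<close>, with the gradient moved to \<open>l\<close>, gives the quadratic term with
  coefficient \<open>L_ll P\<close> rather than \<open>L_ll P / 2\<close>. The definition of \<open>LD P\<close> leaves room for this.
\<close>

lemma Phi_above_quadratic:
  assumes "x \<in> X" "l \<in> Y" "v \<in> Y"
  shows "Phi P x l + blinfun_apply (grad_l (Phi P) x l) (v - l) - L_ll P * (norm (v - l))\<^sup>2 \<le> Phi P x v"
proof -
  have lip: "norm (grad_l (Phi P) x l - grad_l (Phi P) x v) \<le> L_ll P * norm (v - l)"
    using setting assms unfolding saddle_setting_def by (metis norm_minus_commute)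
  have "Phi P x l \<le> Phi P x v - blinfun_apply (grad_l (Phi P) x v) (v - l)"
    using Phi_below_tangent[OF assms(1,3,2)] by (simp add: blinfun.diff_right)
  with blinfun_diff_le[OF lip, of "v - l"] show ?thesis by (simp add: power2_eq_square mult.assoc)
qed

text \<open>
  A quadratic lower bound at \<open>l\<close> for the dual function \<open>v \<mapsto> inf\<^sub>y primal y v\<close>, with the gradient taken at
  an inexact minimizer \<open>x1\<close>. A competitor \<open>y\<close> far from \<open>x1\<close> pays \<open>mu_f P / 4 * \<parallel>y - x1\<parallel>\<^sup>2\<close> at \<open>l\<close>; changing the
  gradient from \<open>y\<close> to \<open>x1\<close> costs at most \<open>L_lx P * \<parallel>y - x1\<parallel> * \<parallel>v - l\<parallel>\<close>. The worst case of the difference is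
  the summand \<open>(L_lx P)\<^sup>2 / mu_f P\<close> of \<open>LD P\<close>.
\<close>

lemma dual_function_lower_model:
  assumes x1: "x1 \<in> X" and l: "l \<in> Y" and near: "\<And>y. y \<in> X \<Longrightarrow> primal x1 l \<le> primal y l + e"
    and y: "y \<in> X" and v: "v \<in> Y"
  shows "primal x1 l + blinfun_apply (grad_l (Phi P) x1 l) (v - l) - LD P * (norm (v - l))\<^sup>2 - 2 * e
           \<le> primal y v"
proof -
  define a b where "a = norm (y - x1)" and "b = norm (v - l)"
  have "(1 / 2) *\<^sub>R (y + x1) \<in> X" using y x1 by (intro midpoint_in_convex convex_X)
  then have 1: "primal x1 l + mu_f P / 4 * a\<^sup>2 - 2 * e \<le> primal y l"
    using near[of "(1 / 2) *\<^sub>R (y + x1)"] primal_midpoint[OF y x1 l] unfolding a_def by simp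
  have 2: "primal y l + blinfun_apply (grad_l (Phi P) y l) (v - l) - L_ll P * b\<^sup>2 \<le> primal y v"
    using Phi_above_quadratic[OF y l v] by (simp add: primal_def b_def)
  have lip: "norm (grad_l (Phi P) x1 l - grad_l (Phi P) y l) \<le> L_lx P * a"
    using setting x1 y l unfolding saddle_setting_def a_def by (metis norm_minus_commute)
  have 3: "blinfun_apply (grad_l (Phi P) x1 l) (v - l) \<le> blinfun_apply (grad_l (Phi P) y l) (v - l) + L_lx P * a * b"
    using blinfun_diff_le[OF lip, of "v - l"] by (simp add: b_def)
  have "0 \<le> mu_f P / 4 * (a - 2 * L_lx P * b / mu_f P)\<^sup>2" using mu_pos by simp
  also have "\<dots> = mu_f P / 4 * a\<^sup>2 - L_lx P * a * b + (L_lx P)\<^sup>2 / mu_f P * b\<^sup>2"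
    using mu_pos by (simp add: field_simps power2_eq_square)
  finally have 4: "L_lx P * a * b \<le> mu_f P / 4 * a\<^sup>2 + (L_lx P)\<^sup>2 / mu_f P * b\<^sup>2" by simp
  have "LD P * b\<^sup>2 = L_ll P * b\<^sup>2 + (L_lx P)\<^sup>2 / mu_f P * b\<^sup>2" by (simp add: LD_def distrib_right)
  with 1 2 3 4 show ?thesis by (simp add: b_def)
qed

section \<open>The smoothed duality gap contracts\<close>

text \<open>
  The inequality \<open>\<psi>\<^sup>P\<^sub>\<rho>(x) - \<psi>\<^sup>D(l) \<le> G\<close>, with the supremum and the infimum resolved into
  quantifiers so that all terms are real.
\<close>

definition smoothed_gap_le :: "real \<Rightarrow> 'a \<Rightarrow> 'b \<Rightarrow> real \<Rightarrow> bool" where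
  "smoothed_gap_le \<rho> x l G \<longleftrightarrow>
     (\<forall>y\<in>X. \<forall>v\<in>Y. (primal x v - h v - \<rho> * omega v) - (primal y l - h l) \<le> G)"

text \<open>
  At a competitor \<open>v\<close> the new primal value is, up to \<open>e\<close>, at most its value at \<open>l2\<close>, which convexity in
  \<open>x\<close> splits into a value at \<open>x\<close> with weight \<open>t\<close> and a value at \<open>x1\<close> with weight \<open>1 - t\<close>. The first is
  bounded by the old gap with \<open>x1\<close> as the competing primal point, less the strong-concavity gain. The
  second cancels against the linear model of the dual function at \<open>lhat\<close>: since
  \<open>l' - lhat = t (l - lhat) + (1 - t) (l2 - lhat)\<close>, concavity in \<open>l\<close> places the model above
  \<open>t * primal x1 l + (1 - t) * primal x1 l2\<close>. The errors add up to \<open>e\<close> from \<open>l2\<close>, \<open>t e\<close> from \<open>l1\<close> and \<open>2 e\<close>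
  from \<open>x1\<close>.
\<close>

lemma smoothed_gap_step:
  fixes x :: 'a and l :: 'b
  assumes mem: "x \<in> X" "l \<in> Y" "l1 \<in> Y" "x1 \<in> X" "l2 \<in> Y"
    and t: "0 < t" "t < 1" and rho: "0 < \<rho>" and e: "0 \<le> e"
    and small: "(1 - t)\<^sup>2 * LD P \<le> t * \<rho> / 4"
  defines "lhat \<equiv> t *\<^sub>R l + (1 - t) *\<^sub>R l1"
    and "x' \<equiv> t *\<^sub>R x + (1 - t) *\<^sub>R x1"
    and "l' \<equiv> t *\<^sub>R l + (1 - t) *\<^sub>R l2"
  assumes opt1: "\<And>v. v \<in> Y \<Longrightarrow> smoothed_dual \<rho> x v \<le> smoothed_dual \<rho> x l1 + e"
    and opt: "\<And>y. y \<in> X \<Longrightarrow> primal x1 lhat \<le> primal y lhat + e"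
    and opt2: "\<And>v. v \<in> Y \<Longrightarrow> smoothed_dual (t * \<rho>) x' v \<le> smoothed_dual (t * \<rho>) x' l2 + e"
    and gap: "smoothed_gap_le \<rho> x l G"
  shows "smoothed_gap_le (t * \<rho>) x' l' (t * G + 4 * e)"
  unfolding smoothed_gap_le_def
proof (intro ballI)
  fix y v assume y: "y \<in> X" and v: "v \<in> Y"
  have lhat: "lhat \<in> Y" and x': "x' \<in> X" and l': "l' \<in> Y"
    unfolding lhat_def x'_def l'_def using mem t
    by (auto intro!: convexD convex_X convex_Y)
  define d where "d = (norm (l1 - l2))\<^sup>2"
  define \<phi> where "\<phi> x = f_real P x + real_of_ereal (g_part P x)" for x
  have prim: "primal z u = \<phi> z + Phi P z u" for z u by (simp add: primal_def \<phi>_def)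
  have cv: "primal x' l2 \<le> t * primal x l2 + (1 - t) * primal x1 l2"
    using primal_convex[OF mem(5)] mem t unfolding convex_on_def x'_def by auto
  have hcv: "h l' \<le> t * h l + (1 - t) * h l2"
    using h_convex mem t unfolding convex_on_def l'_def by auto
  \<comment> \<open>Comparing the near-maximizer \<open>l1\<close> with the midpoint \<open>m\<close> shows that \<open>m\<close> beats \<open>l2\<close> by almost
    \<open>\<rho> / 4 * d\<close>; the old gap is then used at \<open>m\<close>.\<close>
  define m where "m = (1 / 2) *\<^sub>R (l1 + l2)"
  have m: "m \<in> Y" unfolding m_def using mem by (intro midpoint_in_convex convex_Y)
  have "smoothed_dual \<rho> x l2 + \<rho> / 4 * d - e \<le> smoothed_dual \<rho> x m"
    using opt1[OF m] smoothed_dual_midpoint[OF mem(1,3,5) rho] unfolding m_def[symmetric] d_def by linarith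
  moreover have "(primal x m - h m - \<rho> * omega m) - (primal x1 l - h l) \<le> G"
    using gap mem(4) m unfolding smoothed_gap_le_def by blast
  ultimately have "\<phi> x + smoothed_dual \<rho> x l2 \<le> G + primal x1 l - h l + e - \<rho> / 4 * d"
    by (simp add: smoothed_dual_def prim)
  then have A: "t * (\<phi> x + smoothed_dual \<rho> x l2) \<le> t * (G + primal x1 l - h l + e - \<rho> / 4 * d)"
    using t by (intro mult_left_mono) auto
  have "primal x' v - h v - (t * \<rho>) * omega v \<le> primal x' l2 - h l2 - (t * \<rho>) * omega l2 + e"
    using opt2[OF v] by (simp add: smoothed_dual_def prim)
  also have "\<dots> \<le> t * (\<phi> x + smoothed_dual \<rho> x l2) + (1 - t) * (primal x1 l2 - h l2) + e"
    using cv by (simp add: smoothed_dual_def prim algebra_simps)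
  finally have B: "primal x' v - h v - (t * \<rho>) * omega v
      \<le> t * (\<phi> x + smoothed_dual \<rho> x l2) + (1 - t) * (primal x1 l2 - h l2) + e" .
  \<comment> \<open>The lower bound on the dual function at \<open>l'\<close>, through the model at \<open>lhat\<close>.\<close>
  define g where "g = blinfun_apply (grad_l (Phi P) x1 lhat)"
  have lin: "g (l' - lhat) = t * g (l - lhat) + (1 - t) * g (l2 - lhat)"
  proof -
    have "l' - lhat = t *\<^sub>R (l - lhat) + (1 - t) *\<^sub>R (l2 - lhat)"
      by (simp add: l'_def algebra_simps)
    then show ?thesis unfolding g_def by (simp add: blinfun.add_right blinfun.scaleR_right)
  qed
  have "l' - lhat = (1 - t) *\<^sub>R (l2 - l1)" by (simp add: l'_def lhat_def algebra_simps)
  then have nrm: "(norm (l' - lhat))\<^sup>2 = (1 - t)\<^sup>2 * d"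
    by (simp add: power_mult_distrib d_def norm_minus_commute)
  have T: "primal x1 l \<le> primal x1 lhat + g (l - lhat)" "primal x1 l2 \<le> primal x1 lhat + g (l2 - lhat)"
    using Phi_below_tangent[OF mem(4) lhat] mem by (auto simp: g_def prim)
  have "t * primal x1 l + (1 - t) * primal x1 l2
      \<le> t * (primal x1 lhat + g (l - lhat)) + (1 - t) * (primal x1 lhat + g (l2 - lhat))"
    using T t by (intro add_mono mult_left_mono) auto
  also have "\<dots> = primal x1 lhat + g (l' - lhat)" unfolding lin by (simp add: algebra_simps)
  also have "\<dots> \<le> primal y l' + LD P * ((1 - t)\<^sup>2 * d) + 2 * e"
    using dual_function_lower_model[OF mem(4) lhat opt y l'] unfolding nrm g_def by simp
  finally have C: "t * primal x1 l + (1 - t) * primal x1 l2 \<le> primal y l' + LD P * ((1 - t)\<^sup>2 * d) + 2 * e" .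
  have D: "LD P * ((1 - t)\<^sup>2 * d) \<le> t * \<rho> / 4 * d"
    using mult_right_mono[OF small, of d] by (simp add: d_def mult.commute mult.left_commute)
  have E: "t * e \<le> e" using t e by (simp add: mult_left_le_one_le)
  have A': "t * (\<phi> x + smoothed_dual \<rho> x l2) \<le> t * G + t * primal x1 l - t * h l + t * e - t * \<rho> / 4 * d"
    using A by (simp add: algebra_simps)
  have B': "primal x' v - h v - (t * \<rho>) * omega v
      \<le> t * (\<phi> x + smoothed_dual \<rho> x l2) + (1 - t) * primal x1 l2 - (1 - t) * h l2 + e"
    using B by (simp add: algebra_simps)
  show "primal x' v - h v - t * \<rho> * omega v - (primal y l' - h l') \<le> t * G + 4 * e"
    using A' B' C D E hcv by linarith
qed

end
section \<open>Smoothed gap and duality gap\<close>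

context saddle_point
begin

lemma duality_gap_le:
  assumes x: "x \<in> X" and l: "l \<in> Y"
    and G: "\<And>y v. y \<in> X \<Longrightarrow> v \<in> Y \<Longrightarrow> (primal x v - h v) - (primal y l - h l) \<le> G"
  shows "duality_gap P x l \<le> ereal G"
proof -
  have up: "psiP P x \<le> ereal (G + (primal y l - h l))" if "y \<in> X" for y
    unfolding psiP_def using x G[OF that] by (intro SUP_least) (auto simp: Sfun_eq algebra_simps)
  have "Sfun P x l \<le> psiP P x" unfolding psiP_def using l by (rule SUP_upper)
  then obtain p where p: "psiP P x = ereal p"
    using up[OF x] x l by (cases "psiP P x") (auto simp: Sfun_eq)
  have "ereal (p - G + h l) \<le> psiD_hat P l"
    unfolding psiD_hat_def using up p by (intro INF_greatest) (auto simp: SP_hat_eq algebra_simps)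
  moreover have "psiD_hat P l \<le> SP_hat P x l" unfolding psiD_hat_def using x by (rule INF_lower)
  ultimately obtain q where "psiD_hat P l = ereal q" "p - G + h l \<le> q"
    using x by (cases "psiD_hat P l") (auto simp: SP_hat_eq)
  then show ?thesis using p l by (simp add: duality_gap_def psiD_def h_part_eq)
qed

text \<open>
  Reading the duality gap as a real number is legitimate because both extremal values are finite:
  the tangents of \<open>Phi\<close> and \<open>f\<close> at \<open>(x, l)\<close> reduce the claim to lower bounds for \<open>h\<close> and \<open>g\<close> plus a linear
  function.
\<close>

lemma gap_le_duality_gap:
  assumes bd: "bounded Y" and x: "x \<in> X" and l: "l \<in> Y" and y: "y \<in> X" and v: "v \<in> Y"
  shows "(primal x v - h v) - (primal y l - h l) \<le> real_of_ereal (duality_gap P x l)"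
proof -
  define G where "G = grad_l (Phi P) x l"
  obtain c where c: "\<And>u. u \<in> Y \<Longrightarrow> c \<le> h u + blinfun_apply (- G) u"
    using dgf_linear_lower_bound[OF finite_dim_Y Y_nonempty closed_Y bd dgf_D ccp_h Y_dom_h, of "- G"]
    unfolding h_def by blast
  have up: "primal x u - h u \<le> primal x l - blinfun_apply G l - c" if "u \<in> Y" for u
    using c[OF that] Phi_below_tangent[OF x l that]
    by (simp add: primal_def G_def blinfun.diff_right blinfun.minus_left)
  define H where "H = gradient (f_real P) x + grad_x (Phi P) x l"
  obtain c' where c': "\<And>u. u \<in> X \<Longrightarrow> c' \<le> real_of_ereal (g_part P u) + blinfun_apply H u"
    using dgf_linear_lower_bound[OF finite_dim_X X_nonempty closed_X bounded_X dgf_P ccp_g X_dom_g, of H]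
    by blast
  have lo: "f_real P x + Phi P x l - blinfun_apply H x + c' \<le> primal u l" if "u \<in> X" for u
    using c'[OF that] convex_on_above_tangent[OF f_convex x that f_derivative[OF x]]
      convex_on_above_tangent[OF Phi_convex[OF l] x that Phi_derivative_x[OF x l]]
    by (simp add: primal_def H_def blinfun.diff_right blinfun.add_left)
  have P1: "Sfun P x u \<le> psiP P x" if "u \<in> Y" for u unfolding psiP_def using that by (rule SUP_upper)
  have "psiP P x \<le> ereal (primal x l - blinfun_apply G l - c)"
    unfolding psiP_def using x up by (intro SUP_least) (simp add: Sfun_eq)
  then obtain p where p: "psiP P x = ereal p"
    using P1[OF l] x l by (cases "psiP P x") (auto simp: Sfun_eq)
  have D1: "psiD_hat P l \<le> SP_hat P u l" if "u \<in> X" for u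
    unfolding psiD_hat_def using that by (rule INF_lower)
  have "ereal (f_real P x + Phi P x l - blinfun_apply H x + c') \<le> psiD_hat P l"
    unfolding psiD_hat_def using lo by (intro INF_greatest) (simp add: SP_hat_eq)
  then obtain q where q: "psiD_hat P l = ereal q"
    using D1[OF x] x by (cases "psiD_hat P l") (auto simp: SP_hat_eq)
  have "primal x v - h v \<le> p" using P1[OF v] x v p by (simp add: Sfun_eq)
  moreover have "q \<le> primal y l" using D1[OF y] y q by (simp add: SP_hat_eq)
  ultimately show ?thesis using p q l by (simp add: duality_gap_def psiD_def h_part_eq)
qed

lemma duality_gap_nonneg:
  assumes "bounded Y" "x \<in> X" "l \<in> Y"
  shows "0 \<le> real_of_ereal (duality_gap P x l)"
  using gap_le_duality_gap[OF assms assms(2,3)] by simp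

lemma abs_omega_le_B_omega:
  assumes bd: "bounded Y" and l: "l \<in> Y"
  shows "\<bar>omega l\<bar> \<le> B_omega P"
proof -
  obtain K where "\<And>l. l \<in> Y \<Longrightarrow> \<bar>real_of_ereal (omega_D P l)\<bar> \<le> K"
    using dgf_bounded_on[OF finite_dim_Y Y_nonempty closed_Y bd dgf_D] by blast
  then have "bdd_above ((\<lambda>l. \<bar>real_of_ereal (omega_D P l)\<bar>) ` Y)" by (rule bdd_aboveI2)
  then show ?thesis unfolding B_omega_def omega_def using l by (intro cSUP_upper)
qed

lemma smoothed_gap_leD:
  assumes "bounded Y" "smoothed_gap_le \<rho> x l G" "0 \<le> \<rho>" "x \<in> X" "l \<in> Y"
  shows "duality_gap P x l \<le> ereal (G + \<rho> * B_omega P)"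
proof (rule duality_gap_le[OF assms(4,5)])
  fix y v assume "y \<in> X" "v \<in> Y"
  then have "(primal x v - h v - \<rho> * omega v) - (primal y l - h l) \<le> G"
    using assms(2) unfolding smoothed_gap_le_def by blast
  moreover have "\<rho> * omega v \<le> \<rho> * B_omega P"
    using abs_omega_le_B_omega[OF assms(1) \<open>v \<in> Y\<close>] assms(3) by (intro mult_left_mono) auto
  ultimately show "primal x v - h v - (primal y l - h l) \<le> G + \<rho> * B_omega P" by linarith
qed

lemma smoothed_gap_leI:
  assumes "bounded Y" "0 \<le> \<rho>" "x \<in> X" "l \<in> Y"
  shows "smoothed_gap_le \<rho> x l (real_of_ereal (duality_gap P x l) + \<rho> * B_omega P)"
  unfolding smoothed_gap_le_def
proof (intro ballI)
  fix y v assume yv: "y \<in> X" "v \<in> Y"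
  have "- omega v \<le> B_omega P" using abs_omega_le_B_omega[OF assms(1) yv(2)] by linarith
  then have "\<rho> * - omega v \<le> \<rho> * B_omega P" using assms(2) by (rule mult_left_mono)
  then show "primal x v - h v - \<rho> * omega v - (primal y l - h l)
      \<le> real_of_ereal (duality_gap P x l) + \<rho> * B_omega P"
    using gap_le_duality_gap[OF assms(1,3,4) yv] by simp
qed

end

section \<open>Accuracy of the iterates\<close>

locale ipds_setting = saddle_point P
  for P :: "('a::real_normed_vector, 'b::real_normed_vector) saddle_problem" +
  fixes A :: "('a, 'b) solver" and x0 :: 'a and l0 :: 'b
  assumes apg: "apg_solver P A" and bounded_Y: "bounded (Lset P)"
    and x0: "x0 \<in> Xset P" and l0: "l0 \<in> Lset P"
begin

definition rho :: "nat \<Rightarrow> real" where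
  "rho k = 16 * LD P / ((real k + 1) * (real k + 2))"

definition gap0 :: real where
  "gap0 = real_of_ereal (duality_gap P x0 l0)"

text \<open>
  The solution of the recursion \<open>G\<^sub>k\<^sub>+\<^sub>1 = \<tau>\<^sub>k G\<^sub>k + 4 tol\<^sub>k\<close>: multiplied by \<open>(k + 1) (k + 2)\<close>, the bound
  grows by \<open>\<epsilon> (k + 2)\<close> in each step. The start value allows for smoothing with \<open>\<rho>\<^sub>0 = 8 L\<^sub>D\<close>.
\<close>

definition smoothed_gap_bound :: "real \<Rightarrow> nat \<Rightarrow> real" where
  "smoothed_gap_bound \<epsilon> k =
     (2 * (gap0 + 8 * LD P * B_omega P) + \<epsilon> * real k * (real k + 3) / 2) / ((real k + 1) * (real k + 2))"

lemma rho_pos: "0 < rho k"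
  using LD_pos by (simp add: rho_def)

lemma rho_Suc: "tau k * rho k = rho (Suc k)"
proof -
  have "real k + 3 \<noteq> 0" "real k + 1 \<noteq> 0" "real k + 2 \<noteq> 0" by linarith+
  then show ?thesis unfolding rho_def tau_def of_nat_Suc
    by (simp add: divide_simps) (simp add: algebra_simps)
qed

lemma smoothed_gap_bound_Suc:
  "tau k * smoothed_gap_bound \<epsilon> k + 4 * tol \<epsilon> k = smoothed_gap_bound \<epsilon> (Suc k)"
proof -
  define c where "c = 2 * (gap0 + 8 * LD P * B_omega P)"
  have "real k + 3 \<noteq> 0" "real k + 1 \<noteq> 0" "real k + 2 \<noteq> 0" by linarith+
  then show ?thesis unfolding smoothed_gap_bound_def tau_def tol_def of_nat_Suc c_def[symmetric]
    by (simp add: divide_simps) (simp add: algebra_simps)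
qed

lemma solve_P_near_minimizer:
  assumes "l \<in> Y" "0 < e"
  shows "result P (solve_P P A e l) \<in> X"
    and "y \<in> X \<Longrightarrow> primal (result P (solve_P P A e l)) l \<le> primal y l + e"
proof -
  let ?x = "result P (solve_P P A e l)"
  have *: "?x \<in> X" "SP_hat P ?x l - psiD_hat P l \<le> ereal e"
    using solve_P_accurate[OF setting apg assms] by auto
  show "?x \<in> X" by (rule *)
  assume y: "y \<in> X"
  then have "psiD_hat P l \<le> SP_hat P y l" unfolding psiD_hat_def by (rule INF_lower)
  then have "SP_hat P ?x l - SP_hat P y l \<le> ereal e"
    using *(2) by (meson ereal_minus_mono order_refl order_trans)
  then show "primal ?x l \<le> primal y l + e" using *(1) y by (simp add: SP_hat_eq)
qed

lemma solve_D_near_maximizer: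
  assumes "x \<in> X" "0 < \<rho>" "0 < e"
  shows "result P (solve_D P A \<rho> e x) \<in> Y"
    and "v \<in> Y \<Longrightarrow> smoothed_dual \<rho> x v \<le> smoothed_dual \<rho> x (result P (solve_D P A \<rho> e x)) + e"
proof -
  let ?l = "result P (solve_D P A \<rho> e x)"
  have *: "?l \<in> Y" "psiP_hat P \<rho> x - SD_hat P \<rho> x ?l \<le> ereal e"
    using solve_D_accurate[OF setting apg assms] by auto
  show "?l \<in> Y" by (rule *)
  assume v: "v \<in> Y"
  then have "SD_hat P \<rho> x v \<le> psiP_hat P \<rho> x" unfolding psiP_hat_def by (rule SUP_upper)
  then have "SD_hat P \<rho> x v - SD_hat P \<rho> x ?l \<le> ereal e"
    using *(2) by (meson ereal_minus_mono order_refl order_trans)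
  then show "smoothed_dual \<rho> x v \<le> smoothed_dual \<rho> x ?l + e" using *(1) v by (simp add: SD_hat_eq)
qed

lemma ipds_invariant:
  assumes "0 < \<epsilon>"
  shows "\<exists>x l. result P (ipds P A \<epsilon> x0 l0 k) = (x, l, rho k) \<and> x \<in> X \<and> l \<in> Y \<and>
           smoothed_gap_le (rho k) x l (smoothed_gap_bound \<epsilon> k)"
proof (induction k)
  case 0
  have "smoothed_gap_le (8 * LD P) x0 l0 (gap0 + 8 * LD P * B_omega P)"
    unfolding gap0_def using LD_pos by (intro smoothed_gap_leI bounded_Y x0 l0) simp
  moreover have "rho 0 = 8 * LD P" by (simp add: rho_def)
  moreover have "smoothed_gap_bound \<epsilon> 0 = gap0 + 8 * LD P * B_omega P"
    by (simp add: smoothed_gap_bound_def field_simps)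
  ultimately show ?case using x0 l0 by simp
next
  case (Suc k)
  then obtain x l where res: "result P (ipds P A \<epsilon> x0 l0 k) = (x, l, rho k)"
    and x: "x \<in> X" and l: "l \<in> Y" and gap: "smoothed_gap_le (rho k) x l (smoothed_gap_bound \<epsilon> k)"
    by blast
  let ?t = "tau k"
  have t: "0 < ?t" "?t < 1" by (auto simp: tau_def)
  have e: "0 < tol \<epsilon> k" using assms by (simp add: tol_def)
  define l1 where "l1 = result P (solve_D P A (rho k) (tol \<epsilon> k) x)"
  define lhat where "lhat = ?t *\<^sub>R l + (1 - ?t) *\<^sub>R l1"
  define x1 where "x1 = result P (solve_P P A (tol \<epsilon> k) lhat)"
  define x' where "x' = ?t *\<^sub>R x + (1 - ?t) *\<^sub>R x1"
  define l2 where "l2 = result P (solve_D P A (?t * rho k) (tol \<epsilon> k) x')"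
  define l' where "l' = ?t *\<^sub>R l + (1 - ?t) *\<^sub>R l2"
  have l1: "l1 \<in> Y" unfolding l1_def by (rule solve_D_near_maximizer[OF x rho_pos e])
  have lhat: "lhat \<in> Y" unfolding lhat_def using l l1 t by (intro convexD convex_Y) auto
  have x1: "x1 \<in> X" unfolding x1_def by (rule solve_P_near_minimizer[OF lhat e])
  have x': "x' \<in> X" unfolding x'_def using x x1 t by (intro convexD convex_X) auto
  have pos: "0 < ?t * rho k" using t rho_pos by simp
  have l2: "l2 \<in> Y" unfolding l2_def by (rule solve_D_near_maximizer[OF x' pos e])
  have l': "l' \<in> Y" unfolding l'_def using l l2 t by (intro convexD convex_Y) auto
  have "(1 - ?t)\<^sup>2 * LD P \<le> ?t * rho k / 4"
  proof -
    have "1 - ?t = 2 / (real k + 3)" by (simp add: tau_def field_simps)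
    then have "(1 - ?t)\<^sup>2 * LD P = 4 * LD P / ((real k + 3) * (real k + 3))"
      by (simp add: power2_eq_square)
    also have "\<dots> \<le> 4 * LD P / ((real k + 2) * (real k + 3))"
      using LD_pos by (intro divide_left_mono mult_right_mono) auto
    also have "\<dots> = ?t * rho k / 4" unfolding rho_Suc by (simp add: rho_def add.commute)
    finally show ?thesis .
  qed
  moreover have "smoothed_dual (rho k) x v \<le> smoothed_dual (rho k) x l1 + tol \<epsilon> k" if "v \<in> Y" for v
    unfolding l1_def by (rule solve_D_near_maximizer(2)[OF x rho_pos e that])
  moreover have "primal x1 lhat \<le> primal y lhat + tol \<epsilon> k" if "y \<in> X" for y
    unfolding x1_def by (rule solve_P_near_minimizer(2)[OF lhat e that])
  moreover have "smoothed_dual (?t * rho k) x' v \<le> smoothed_dual (?t * rho k) x' l2 + tol \<epsilon> k"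
    if "v \<in> Y" for v
    unfolding l2_def by (rule solve_D_near_maximizer(2)[OF x' pos e that])
  ultimately have "smoothed_gap_le (?t * rho k) x' l' (?t * smoothed_gap_bound \<epsilon> k + 4 * tol \<epsilon> k)"
    using gap less_imp_le[OF e] unfolding x'_def l'_def lhat_def
    by (intro smoothed_gap_step[OF x l l1 x1 l2 t rho_pos]) auto
  then have "smoothed_gap_le (rho (Suc k)) x' l' (smoothed_gap_bound \<epsilon> (Suc k))"
    by (simp add: rho_Suc smoothed_gap_bound_Suc)
  moreover have "result P (ipds P A \<epsilon> x0 l0 (Suc k)) = (x', l', rho (Suc k))"
    by (simp add: result_and_then res Let_def l1_def lhat_def x1_def x'_def l2_def l'_def rho_Suc)
  ultimately show ?case using x' l' by blast
qed

text \<open>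
  Undoing the smoothing adds \<open>rho K * B_omega P\<close>, which decays like the damped initial gap; both
  together are below \<open>\<epsilon> / 2\<close> for such \<open>K\<close>, and the accumulated errors are below \<open>\<epsilon> / 2\<close> for all \<open>K\<close>.
\<close>

lemma eps_gap_at_large:
  assumes eps: "0 < \<epsilon>" and K: "(4 * gap0 + 64 * (LD P * B_omega P)) / \<epsilon> \<le> (real K)\<^sup>2"
  shows "eps_gap_at P A \<epsilon> x0 l0 K"
proof -
  obtain x l where res: "result P (ipds P A \<epsilon> x0 l0 K) = (x, l, rho K)" and x: "x \<in> X" and l: "l \<in> Y"
    and gap: "smoothed_gap_le (rho K) x l (smoothed_gap_bound \<epsilon> K)"
    using ipds_invariant[OF eps] by blast
  define q where "q = (real K + 1) * (real K + 2)"
  have q: "0 < q" unfolding q_def by (intro mult_pos_pos) auto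
  have q_ge: "(real K)\<^sup>2 \<le> q" "real K * (real K + 3) \<le> q"
    by (auto simp: q_def algebra_simps power2_eq_square)
  define c where "c = 2 * gap0 + 32 * (LD P * B_omega P)"
  have "2 * c \<le> \<epsilon> * (real K)\<^sup>2" using K eps by (simp add: c_def field_simps)
  also have "\<dots> \<le> \<epsilon> * q" using q_ge eps by simp
  finally have 1: "2 * c \<le> \<epsilon> * q" .
  have 2: "\<epsilon> * (real K * (real K + 3)) \<le> \<epsilon> * q" using q_ge eps by simp
  have "smoothed_gap_bound \<epsilon> K + rho K * B_omega P = (c + \<epsilon> * (real K * (real K + 3)) / 2) / q"
    unfolding smoothed_gap_bound_def rho_def c_def q_def[symmetric]
    using q by (simp add: field_simps)
  also have "\<dots> \<le> \<epsilon>" using 1 2 q by (simp add: pos_divide_le_eq)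
  finally have "duality_gap P x l \<le> ereal \<epsilon>"
    using smoothed_gap_leD[OF bounded_Y gap less_imp_le[OF rho_pos] x l]
    by (meson ereal_less_eq(3) order_trans)
  then show ?thesis using res x l by (simp add: eps_gap_at_def)
qed

section \<open>Counting oracle calls\<close>

lemma run_method_calls:
  assumes "\<And>u. primal_calls Q (ev u) = c" "\<And>u. dual_calls Q (ev u) = d"
  shows "primal_calls Q (run_method M ev u0 N) = N * c" "dual_calls Q (run_method M ev u0 N) = N * d"
proof -
  have "primal_calls Q (run_history M ev u0 N) = N * c \<and> dual_calls Q (run_history M ev u0 N) = N * d"
    by (induction N) (auto simp: calls_and_then assms)
  then show "primal_calls Q (run_method M ev u0 N) = N * c" "dual_calls Q (run_method M ev u0 N) = N * d"
    by (auto simp: run_method_def calls_and_then)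
qed

definition N_P :: "real \<Rightarrow> nat" where
  "N_P e = apg_iterations (L_f P + L_xx P) (mu_f P) (max_bregman X (omega_P P) (start_P A)) e"

definition N_D :: "real \<Rightarrow> real \<Rightarrow> nat" where
  "N_D \<rho> e = apg_iterations (L_ll P) \<rho> (max_bregman Y (omega_D P) (start_D A)) e"

lemma solve_calls:
  "primal_calls P (solve_P P A e l) = N_P e * (n_comp P + 1)" "dual_calls P (solve_P P A e l) = 0"
  "primal_calls P (solve_D P A \<rho> e x) = 0" "dual_calls P (solve_D P A \<rho> e x) = N_D \<rho> e * n_comp P"
  unfolding solve_P_def solve_D_def N_P_def N_D_def
  by (simp_all add: run_method_calls[OF eval_calls(1,2)] run_method_calls[OF eval_calls(3,4)])

lemma ipds_calls:
  assumes "0 < \<epsilon>"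
  shows "primal_calls P (ipds P A \<epsilon> x0 l0 K) = (\<Sum>k<K. N_P (tol \<epsilon> k) * (n_comp P + 1))"
    and "dual_calls P (ipds P A \<epsilon> x0 l0 K)
           = (\<Sum>k<K. (N_D (rho k) (tol \<epsilon> k) + N_D (rho (Suc k)) (tol \<epsilon> k)) * n_comp P)"
proof (induction K)
  case (Suc K)
  obtain x l where "result P (ipds P A \<epsilon> x0 l0 K) = (x, l, rho K)"
    using ipds_invariant[OF assms] by blast
  then show "primal_calls P (ipds P A \<epsilon> x0 l0 (Suc K)) = (\<Sum>k<Suc K. N_P (tol \<epsilon> k) * (n_comp P + 1))"
    "dual_calls P (ipds P A \<epsilon> x0 l0 (Suc K))
       = (\<Sum>k<Suc K. (N_D (rho k) (tol \<epsilon> k) + N_D (rho (Suc k)) (tol \<epsilon> k)) * n_comp P)"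
    using Suc by (simp_all add: calls_and_then solve_calls Let_def rho_Suc algebra_simps)
qed simp_all

text \<open>
  The complexities count up to the first successful iterate, and the number of calls is monotone in
  the number of iterations.
\<close>

lemma complexity_le_calls:
  assumes "0 < \<epsilon>" "eps_gap_at P A \<epsilon> x0 l0 K"
  shows "C_P_det P A x0 l0 \<epsilon> \<le> enat (primal_calls P (ipds P A \<epsilon> x0 l0 K))"
    and "C_D_det P A x0 l0 \<epsilon> \<le> enat (dual_calls P (ipds P A \<epsilon> x0 l0 K))"
proof -
  have le: "(LEAST k. eps_gap_at P A \<epsilon> x0 l0 k) \<le> K" using assms(2) by (rule Least_le)
  have "primal_calls P (ipds P A \<epsilon> x0 l0 (LEAST k. eps_gap_at P A \<epsilon> x0 l0 k))
      \<le> primal_calls P (ipds P A \<epsilon> x0 l0 K)"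
    unfolding ipds_calls[OF assms(1)] using le by (intro sum_mono2) auto
  then show "C_P_det P A x0 l0 \<epsilon> \<le> enat (primal_calls P (ipds P A \<epsilon> x0 l0 K))"
    using assms(2) by (auto simp: C_P_det_def)
  have "dual_calls P (ipds P A \<epsilon> x0 l0 (LEAST k. eps_gap_at P A \<epsilon> x0 l0 k))
      \<le> dual_calls P (ipds P A \<epsilon> x0 l0 K)"
    unfolding ipds_calls[OF assms(1)] using le by (intro sum_mono2) auto
  then show "C_D_det P A x0 l0 \<epsilon> \<le> enat (dual_calls P (ipds P A \<epsilon> x0 l0 K))"
    using assms(2) by (auto simp: C_D_det_def)
qed

lemma complexity_le:
  assumes eps: "0 < \<epsilon>" and K: "(4 * gap0 + 64 * (LD P * B_omega P)) / \<epsilon> \<le> (real K)\<^sup>2"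
  shows "(\<And>k. k < K \<Longrightarrow> real (N_P (tol \<epsilon> k)) \<le> c) \<Longrightarrow>
      ereal_of_enat (C_P_det P A x0 l0 \<epsilon>) \<le> ereal (real K * (c * (real (n_comp P) + 1)))"
    and "(\<And>k j. k < K \<Longrightarrow> j \<le> Suc k \<Longrightarrow> real (N_D (rho j) (tol \<epsilon> k)) \<le> c) \<Longrightarrow>
      ereal_of_enat (C_D_det P A x0 l0 \<epsilon>) \<le> ereal (real K * (2 * c * real (n_comp P)))"
proof -
  note gap = eps_gap_at_large[OF eps K]
  {
    assume c: "\<And>k. k < K \<Longrightarrow> real (N_P (tol \<epsilon> k)) \<le> c"
    have "real (primal_calls P (ipds P A \<epsilon> x0 l0 K))
        = (\<Sum>k<K. real (N_P (tol \<epsilon> k)) * (real (n_comp P) + 1))"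
      unfolding ipds_calls[OF eps] by (simp add: algebra_simps)
    also have "\<dots> \<le> (\<Sum>k<K. c * (real (n_comp P) + 1))"
      using c by (intro sum_mono mult_right_mono) auto
    finally show "ereal_of_enat (C_P_det P A x0 l0 \<epsilon>) \<le> ereal (real K * (c * (real (n_comp P) + 1)))"
      using complexity_le_calls(1)[OF eps gap]
      by (cases "C_P_det P A x0 l0 \<epsilon>") auto
  }
  assume c: "\<And>k j. k < K \<Longrightarrow> j \<le> Suc k \<Longrightarrow> real (N_D (rho j) (tol \<epsilon> k)) \<le> c"
  have "real (dual_calls P (ipds P A \<epsilon> x0 l0 K))
      = (\<Sum>k<K. (real (N_D (rho k) (tol \<epsilon> k)) + real (N_D (rho (Suc k)) (tol \<epsilon> k))) * real (n_comp P))"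
    unfolding ipds_calls[OF eps] by simp
  also have "\<dots> \<le> (\<Sum>k<K. (c + c) * real (n_comp P))"
    using c by (intro sum_mono mult_right_mono add_mono) auto
  finally show "ereal_of_enat (C_D_det P A x0 l0 \<epsilon>) \<le> ereal (real K * (2 * c * real (n_comp P)))"
    using complexity_le_calls(2)[OF eps gap]
    by (cases "C_D_det P A x0 l0 \<epsilon>") auto
qed

end

section \<open>Complexity for small accuracies\<close>

text \<open>
  With \<open>k\<close> of order \<open>sqrt (a / \<epsilon>)\<close>, the required reduction \<open>L' * D / (4 * tol \<epsilon> k)\<close> is of order
  \<open>\<epsilon> powr (- 3 / 2)\<close>. Allowing \<open>exp (2 * ln (b / \<epsilon>)) = (b / \<epsilon>)\<^sup>2\<close> leaves a spare factor of order
  \<open>sqrt (a / \<epsilon>)\<close> that absorbs the constants.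
\<close>

lemma apg_accuracy_from_log:
  assumes pos: "0 < L'" "0 < b" "0 < a" "0 < \<epsilon>" and k: "real k + 3 \<le> 4 * sqrt (a / \<epsilon>)"
    and small: "4 * L' * \<bar>D\<bar> * a / b\<^sup>2 \<le> sqrt (a / \<epsilon>)"
  shows "L' / 4 * D \<le> tol \<epsilon> k * exp (2 * ln (b / \<epsilon>))"
proof -
  define s where "s = sqrt (a / \<epsilon>)"
  have s: "0 \<le> s" "s\<^sup>2 = a / \<epsilon>" using pos by (auto simp: s_def)
  have "4 * L' * \<bar>D\<bar> * a \<le> s * b\<^sup>2" using small pos unfolding s_def[symmetric] by (simp add: field_simps)
  then have "4 * L' * \<bar>D\<bar> * a * s \<le> s * b\<^sup>2 * s" using s(1) by (rule mult_right_mono)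
  also have "\<dots> = b\<^sup>2 * (a / \<epsilon>)" using s(2) by (simp add: power2_eq_square mult.commute mult.left_commute)
  finally have "(4 * L' * \<bar>D\<bar> * s) * a \<le> (b\<^sup>2 / \<epsilon>) * a" by (simp add: algebra_simps)
  then have *: "4 * L' * \<bar>D\<bar> * s \<le> b\<^sup>2 / \<epsilon>" using pos(3) by (rule mult_right_le_imp_le)
  have "L' * D * (real k + 3) \<le> L' * \<bar>D\<bar> * (real k + 3)"
    using pos by (intro mult_right_mono mult_left_mono) auto
  also have "\<dots> \<le> L' * \<bar>D\<bar> * (4 * s)"
    using pos k unfolding s_def by (intro mult_left_mono) auto
  finally have "L' * D * (real k + 3) \<le> b\<^sup>2 / \<epsilon>" using * by linarith
  then have "L' * D \<le> b\<^sup>2 / \<epsilon> / (real k + 3)" by (subst pos_le_divide_eq) auto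
  then have "L' / 4 * D \<le> b\<^sup>2 / \<epsilon> / (real k + 3) / 4" by simp
  also have "\<dots> = tol \<epsilon> k * (b / \<epsilon>)\<^sup>2"
    using pos by (simp add: tol_def power2_eq_square)
  also have "(b / \<epsilon>)\<^sup>2 = exp (2 * ln (b / \<epsilon>))"
    using pos by (simp add: exp_double)
  finally show ?thesis .
qed

lemma eventually_le_sqrt_div:
  assumes "0 < a"
  shows "\<forall>\<^sub>F \<epsilon> in at_right (0::real). c \<le> sqrt (a / \<epsilon>)"
proof -
  have "0 < a / (c\<^sup>2 + 1)" using assms by (simp add: add_nonneg_pos)
  then have "\<forall>\<^sub>F \<epsilon> in at_right 0. \<epsilon> \<in> {0<..<a / (c\<^sup>2 + 1)}" by (rule eventually_at_right_real)
  then show ?thesis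
  proof (rule eventually_mono)
    fix \<epsilon> assume e: "\<epsilon> \<in> {0<..<a / (c\<^sup>2 + 1)}"
    then have "\<epsilon> * (c\<^sup>2 + 1) < a" by (simp add: pos_less_divide_eq add_nonneg_pos)
    then have "c\<^sup>2 * \<epsilon> \<le> a" using e by (simp add: algebra_simps)
    then have "c\<^sup>2 \<le> a / \<epsilon>" using e by (simp add: pos_le_divide_eq)
    then show "c \<le> sqrt (a / \<epsilon>)" by (rule real_le_rsqrt)
  qed
qed

lemma eventually_two_le_ln_div:
  assumes "0 < b"
  shows "\<forall>\<^sub>F \<epsilon> in at_right (0::real). 2 \<le> ln (b / \<epsilon>)"
proof -
  have "\<forall>\<^sub>F \<epsilon> in at_right 0. \<epsilon> \<in> {0<..<b / exp 2}"
    by (rule eventually_at_right_real) (use assms in simp)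
  then show ?thesis
  proof (rule eventually_mono)
    fix \<epsilon> assume "\<epsilon> \<in> {0<..<b / exp 2}"
    then have "0 < \<epsilon>" "exp 2 \<le> b / \<epsilon>" by (auto simp: field_simps)
    then show "2 \<le> ln (b / \<epsilon>)" using assms by (simp add: ln_ge_iff)
  qed
qed

context ipds_setting
begin

text \<open>
  The number of outer iterations is about \<open>sqrt (outer_scale / \<epsilon>)\<close>. The summand \<open>LD P\<close> keeps the scale
  positive when the initial gap and \<open>B_omega P\<close> both vanish.
\<close>

definition outer_scale :: real where
  "outer_scale = 4 * gap0 + 64 * (LD P * B_omega P) + LD P"

lemma outer_scale_eq: "outer_scale = (4 * (gap0 / LD P) + 64 * B_omega P + 1) * LD P"
  using LD_pos by (simp add: outer_scale_def field_simps)

lemma B_omega_nonneg: "0 \<le> B_omega P"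
  using abs_omega_le_B_omega[OF bounded_Y l0] by linarith

lemma gap0_nonneg: "0 \<le> gap0"
  unfolding gap0_def by (rule duality_gap_nonneg[OF bounded_Y x0 l0])

lemma outer_scale_pos: "0 < outer_scale"
  unfolding outer_scale_def using gap0_nonneg B_omega_nonneg LD_pos by (intro add_nonneg_pos) auto

lemma outer_iterations:
  assumes eps: "0 < \<epsilon>" and s: "1 \<le> sqrt (outer_scale / \<epsilon>)"
  defines "K \<equiv> nat \<lceil>sqrt (outer_scale / \<epsilon>)\<rceil>"
  shows "(4 * gap0 + 64 * (LD P * B_omega P)) / \<epsilon> \<le> (real K)\<^sup>2"
    and "real K \<le> 2 * sqrt (outer_scale / \<epsilon>)" and "real K + 2 \<le> 4 * sqrt (outer_scale / \<epsilon>)"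
proof -
  have K: "sqrt (outer_scale / \<epsilon>) \<le> real K" "real K \<le> sqrt (outer_scale / \<epsilon>) + 1"
    using s by (auto simp: K_def)
  have "(4 * gap0 + 64 * (LD P * B_omega P)) / \<epsilon> \<le> outer_scale / \<epsilon>"
    using eps LD_pos by (intro divide_right_mono) (auto simp: outer_scale_def)
  also have "\<dots> = (sqrt (outer_scale / \<epsilon>))\<^sup>2" using outer_scale_pos eps by simp
  also have "\<dots> \<le> (real K)\<^sup>2" using K(1) s by (intro power_mono) auto
  finally show "(4 * gap0 + 64 * (LD P * B_omega P)) / \<epsilon> \<le> (real K)\<^sup>2" .
  show "real K \<le> 2 * sqrt (outer_scale / \<epsilon>)" "real K + 2 \<le> 4 * sqrt (outer_scale / \<epsilon>)"
    using K(2) s by linarith+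
qed

lemma primal_complexity_at:
  fixes \<epsilon> :: real
  defines "s \<equiv> sqrt (outer_scale / \<epsilon>)" and "b \<equiv> (L_f P + L_xx P) * LD P"
  defines "T \<equiv> ln (b / \<epsilon>)"
  assumes eps: "0 < \<epsilon>" and s: "1 \<le> s"
    and acc: "4 * (L_f P + L_xx P) * \<bar>max_bregman X (omega_P P) (start_P A)\<bar> * outer_scale / b\<^sup>2 \<le> s"
    and T: "2 \<le> T"
  shows "ereal_of_enat (C_P_det P A x0 l0 \<epsilon>)
    \<le> ereal (16 * sqrt (4 * (gap0 / LD P) + 64 * B_omega P + 1)
              * (real (n_comp P) * sqrt (kappa_X P * LD P / \<epsilon>) * T))"
proof -
  have L: "0 < L_f P + L_xx P" using mu_pos mu_le_L L_xx_nonneg by linarith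
  have b: "0 < b" unfolding b_def using L LD_pos by simp
  define q where "q = sqrt (kappa_X P)"
  have "1 \<le> kappa_X P" unfolding kappa_X_def using mu_pos mu_le_L L_xx_nonneg by (simp add: le_divide_eq)
  then have q: "1 \<le> q" by (simp add: q_def)
  define K where "K = nat \<lceil>s\<rceil>"
  note outer = outer_iterations[OF eps s[unfolded s_def], folded s_def, folded K_def]
  have "sqrt 2 \<le> 2" by (rule real_le_lsqrt) auto
  then have q2: "sqrt (2 * kappa_X P) \<le> 2 * q"
    unfolding real_sqrt_mult q_def[symmetric] using q by (intro mult_right_mono) auto
  have N: "real (N_P (tol \<epsilon> k)) \<le> 4 * q * T" if k: "k < K" for k
  proof -
    have tol: "0 < tol \<epsilon> k" using eps by (simp add: tol_def)
    have "(L_f P + L_xx P) / 4 * max_bregman X (omega_P P) (start_P A) \<le> tol \<epsilon> k * exp (2 * T)"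
      unfolding T_def
      by (rule apg_accuracy_from_log[OF L b outer_scale_pos eps _ acc[unfolded s_def]])
        (use k outer(3) in \<open>simp add: s_def\<close>)
    then have "real (N_P (tol \<epsilon> k)) \<le> 2 + (1 + sqrt (2 * kappa_X P)) / 2 * (2 * T)"
      unfolding N_P_def kappa_X_def using T by (intro apg_iterations_le L mu_pos tol) auto
    also have "\<dots> \<le> 2 + (1 + 2 * q) / 2 * (2 * T)" using q2 T by (intro add_left_mono mult_right_mono) auto
    also have "\<dots> = 2 + T + 2 * (q * T)" by (simp add: field_simps)
    also have "\<dots> \<le> 4 * q * T"
    proof -
      have "T \<le> q * T" using mult_right_mono[OF q, of T] T by linarith
      then show ?thesis using T by linarith
    qed
    finally show ?thesis .
  qed
  have "real K * (4 * q * T * (real (n_comp P) + 1)) \<le> (2 * s) * (4 * q * T * (2 * real (n_comp P)))"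
    using outer(2) q T n_pos s by (intro mult_mono) auto
  also have "\<dots> = 16 * (s * q) * (real (n_comp P) * T)" by simp
  also have "s * q = sqrt (4 * (gap0 / LD P) + 64 * B_omega P + 1) * sqrt (kappa_X P * LD P / \<epsilon>)"
    unfolding s_def q_def outer_scale_eq real_sqrt_mult[symmetric] by (simp add: mult_ac)
  finally have "real K * (4 * q * T * (real (n_comp P) + 1))
      \<le> 16 * sqrt (4 * (gap0 / LD P) + 64 * B_omega P + 1)
          * (real (n_comp P) * sqrt (kappa_X P * LD P / \<epsilon>) * T)" by (simp add: mult_ac)
  then show ?thesis
    using complexity_le(1)[OF eps outer(1) N] by (meson ereal_less_eq(3) order_trans)
qed

text \<open>
  The condition number \<open>L_ll P / rho j\<close> grows like \<open>(r * j)\<^sup>2\<close>, so the last sub-problems dominate and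
  the sum over the iterations is of order \<open>r * s\<^sup>2\<close>. The condition \<open>2 / r \<le> s\<close> says that the contribution
  \<open>r * s\<close> of the condition number exceeds the additive constants of the step count.
\<close>

lemma dual_complexity_at:
  fixes \<epsilon> :: real
  defines "s \<equiv> sqrt (outer_scale / \<epsilon>)" and "b \<equiv> L_ll P * LD P"
    and "r \<equiv> sqrt (L_ll P / (8 * LD P))"
  defines "T \<equiv> ln (b / \<epsilon>)"
  assumes L: "0 < L_ll P" and eps: "0 < \<epsilon>" and s: "1 \<le> s" "2 / r \<le> s"
    and acc: "4 * L_ll P * \<bar>max_bregman Y (omega_D P) (start_D A)\<bar> * outer_scale / b\<^sup>2 \<le> s"
    and T: "2 \<le> T"
  shows "ereal_of_enat (C_D_det P A x0 l0 \<epsilon>)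
    \<le> ereal (20 * (4 * (gap0 / LD P) + 64 * B_omega P + 1)
              * (real (n_comp P) * (sqrt (L_ll P * LD P) / \<epsilon>) * T))"
proof -
  have b: "0 < b" unfolding b_def using L LD_pos by simp
  have r: "0 < r" unfolding r_def using L LD_pos by simp
  define K where "K = nat \<lceil>s\<rceil>"
  note outer = outer_iterations[OF eps s(1)[unfolded s_def], folded s_def, folded K_def]
  have rs: "2 \<le> r * s" using s(2) r by (simp add: field_simps)
  have N: "real (N_D (rho j) (tol \<epsilon> k)) \<le> 5 * (r * s) * T" if k: "k < K" and j: "j \<le> Suc k" for k j
  proof -
    have tol: "0 < tol \<epsilon> k" using eps by (simp add: tol_def)
    have "2 * (L_ll P / rho j) = L_ll P / (8 * LD P) * ((real j + 1) * (real j + 2))"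
      using LD_pos by (simp add: rho_def field_simps)
    also have "\<dots> \<le> L_ll P / (8 * LD P) * ((4 * s) * (4 * s))"
      using j k outer(3) L LD_pos s(1) by (intro mult_left_mono mult_mono) auto
    finally have "sqrt (2 * (L_ll P / rho j)) \<le> sqrt (L_ll P / (8 * LD P) * ((4 * s) * (4 * s)))"
      by (rule real_sqrt_le_mono)
    also have "\<dots> = r * (4 * s)" 
      unfolding r_def real_sqrt_mult[of "L_ll P / (8 * LD P)"] real_sqrt_abs2 using s(1) by simp
    finally have cond: "sqrt (2 * (L_ll P / rho j)) \<le> 4 * (r * s)" by simp
    have "L_ll P / 4 * max_bregman Y (omega_D P) (start_D A) \<le> tol \<epsilon> k * exp (2 * T)"
      unfolding T_def
      by (rule apg_accuracy_from_log[OF L b outer_scale_pos eps _ acc[unfolded s_def]])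
        (use k outer(3) in \<open>simp add: s_def\<close>)
    then have "real (N_D (rho j) (tol \<epsilon> k)) \<le> 2 + (1 + sqrt (2 * (L_ll P / rho j))) / 2 * (2 * T)"
      unfolding N_D_def using T by (intro apg_iterations_le L rho_pos tol) auto
    also have "\<dots> \<le> 2 + (1 + 4 * (r * s)) / 2 * (2 * T)"
      using cond T by (intro add_left_mono mult_right_mono) auto
    also have "\<dots> = 2 + T + 4 * (r * s * T)" by (simp add: field_simps)
    also have "\<dots> \<le> 5 * (r * s) * T"
    proof -
      have "2 * T \<le> r * s * T" using mult_right_mono[OF rs, of T] T by linarith
      then show ?thesis using T by linarith
    qed
    finally show ?thesis .
  qed
  have "real K * (2 * (5 * (r * s) * T) * real (n_comp P))
      \<le> (2 * s) * (2 * (5 * (r * s) * T) * real (n_comp P))"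
    using outer(2) r s(1) T by (intro mult_right_mono mult_nonneg_nonneg) auto
  also have "\<dots> = 20 * (r * s\<^sup>2) * (real (n_comp P) * T)" by (simp add: power2_eq_square)
  also have "\<dots> \<le> 20 * ((4 * (gap0 / LD P) + 64 * B_omega P + 1) * (sqrt (L_ll P * LD P) / \<epsilon>))
      * (real (n_comp P) * T)"
  proof (intro mult_right_mono mult_left_mono)
    have "r * LD P \<le> sqrt (L_ll P / LD P) * LD P"
      unfolding r_def using L LD_pos by (intro mult_right_mono real_sqrt_le_mono divide_left_mono) auto
    also have "\<dots> = sqrt (L_ll P / LD P * (LD P)\<^sup>2)" using LD_pos unfolding real_sqrt_mult by simp
    also have "L_ll P / LD P * (LD P)\<^sup>2 = L_ll P * LD P" using LD_pos by (simp add: power2_eq_square)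
    finally have rL: "r * LD P \<le> sqrt (L_ll P * LD P)" .
    have c: "0 \<le> 4 * (gap0 / LD P) + 64 * B_omega P + 1"
      using gap0_nonneg LD_pos B_omega_nonneg by simp
    have "r * s\<^sup>2 = (4 * (gap0 / LD P) + 64 * B_omega P + 1) * (r * LD P / \<epsilon>)"
      unfolding s_def using outer_scale_pos eps by (simp add: outer_scale_eq)
    also have "\<dots> \<le> (4 * (gap0 / LD P) + 64 * B_omega P + 1) * (sqrt (L_ll P * LD P) / \<epsilon>)"
      using rL eps c by (intro mult_left_mono divide_right_mono) auto
    finally show "r * s\<^sup>2 \<le> (4 * (gap0 / LD P) + 64 * B_omega P + 1) * (sqrt (L_ll P * LD P) / \<epsilon>)" .
  qed (use T in auto)
  finally have "real K * (2 * (5 * (r * s) * T) * real (n_comp P))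
      \<le> 20 * (4 * (gap0 / LD P) + 64 * B_omega P + 1)
          * (real (n_comp P) * (sqrt (L_ll P * LD P) / \<epsilon>) * T)" by (simp add: mult_ac)
  then show ?thesis
    using complexity_le(2)[OF eps outer(1) N] by (meson ereal_less_eq(3) order_trans)
qed

lemma eventually_primal_complexity:
  "\<forall>\<^sub>F \<epsilon> in at_right 0. ereal_of_enat (C_P_det P A x0 l0 \<epsilon>)
    \<le> ereal (16 * sqrt (4 * (gap0 / LD P) + 64 * B_omega P + 1)
              * (real (n_comp P) * sqrt (kappa_X P * LD P / \<epsilon>) * ln ((L_f P + L_xx P) * LD P / \<epsilon>)))"
proof -
  have "0 < (L_f P + L_xx P) * LD P" using mu_pos mu_le_L L_xx_nonneg LD_pos by simp
  from eventually_two_le_ln_div[OF this] eventually_le_sqrt_div[OF outer_scale_pos, of 1]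
    eventually_le_sqrt_div[OF outer_scale_pos, of "4 * (L_f P + L_xx P)
      * \<bar>max_bregman X (omega_P P) (start_P A)\<bar> * outer_scale / ((L_f P + L_xx P) * LD P)\<^sup>2"]
    eventually_at_right_less[of 0]
  show ?thesis by eventually_elim (rule primal_complexity_at)
qed

lemma eventually_dual_complexity:
  assumes "0 < L_ll P"
  shows "\<forall>\<^sub>F \<epsilon> in at_right 0. ereal_of_enat (C_D_det P A x0 l0 \<epsilon>)
    \<le> ereal (20 * (4 * (gap0 / LD P) + 64 * B_omega P + 1)
              * (real (n_comp P) * (sqrt (L_ll P * LD P) / \<epsilon>) * ln (L_ll P * LD P / \<epsilon>)))"
proof -
  have "0 < L_ll P * LD P" using assms LD_pos by simp
  from eventually_two_le_ln_div[OF this] eventually_le_sqrt_div[OF outer_scale_pos, of 1]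
    eventually_le_sqrt_div[OF outer_scale_pos, of "2 / sqrt (L_ll P / (8 * LD P))"]
    eventually_le_sqrt_div[OF outer_scale_pos, of "4 * L_ll P
      * \<bar>max_bregman Y (omega_D P) (start_D A)\<bar> * outer_scale / (L_ll P * LD P)\<^sup>2"]
    eventually_at_right_less[of 0]
  show ?thesis by eventually_elim (rule dual_complexity_at[OF assms])
qed

end

theorem theorem3p7:
  shows "\<exists>CP CD :: real \<Rightarrow> real \<Rightarrow> real.
    \<forall>(P :: ('a::real_normed_vector, 'b::real_normed_vector) saddle_problem) A x0 l0.
      saddle_setting P \<and> apg_solver P A \<and> bounded (Lset P) \<and> x0 \<in> Xset P \<and> l0 \<in> Lset P \<longrightarrow>
      (let B = B_omega P; \<delta> = real_of_ereal (duality_gap P x0 l0) / LD P; n = real (n_comp P) in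
       (\<forall>\<^sub>F \<epsilon> in at_right 0.
          ereal_of_enat (C_P_det P A x0 l0 \<epsilon>)
            \<le> ereal (CP B \<delta> * (n * sqrt (kappa_X P * LD P / \<epsilon>) * ln ((L_f P + L_xx P) * LD P / \<epsilon>)))) \<and>
       (0 < L_ll P \<longrightarrow>
        (\<forall>\<^sub>F \<epsilon> in at_right 0.
          ereal_of_enat (C_D_det P A x0 l0 \<epsilon>)
            \<le> ereal (CD B \<delta> * (n * (sqrt (L_ll P * LD P) / \<epsilon>) * ln (L_ll P * LD P / \<epsilon>))))))"
proof (intro exI allI impI, elim conjE)
  fix P :: "('a, 'b) saddle_problem" and A x0 l0
  assume *: "saddle_setting P" "apg_solver P A" "bounded (Lset P)" "x0 \<in> Xset P" "l0 \<in> Lset P"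
  interpret ipds_setting P A x0 l0 by unfold_locales (fact *)+
  let ?CP = "\<lambda>B \<delta> :: real. 16 * sqrt (4 * \<delta> + 64 * B + 1)"
  let ?CD = "\<lambda>B \<delta> :: real. 20 * (4 * \<delta> + 64 * B + 1)"
  show "let B = B_omega P; \<delta> = real_of_ereal (duality_gap P x0 l0) / LD P; n = real (n_comp P) in
       (\<forall>\<^sub>F \<epsilon> in at_right 0.
          ereal_of_enat (C_P_det P A x0 l0 \<epsilon>)
            \<le> ereal (?CP B \<delta> * (n * sqrt (kappa_X P * LD P / \<epsilon>) * ln ((L_f P + L_xx P) * LD P / \<epsilon>)))) \<and>
       (0 < L_ll P \<longrightarrow>
        (\<forall>\<^sub>F \<epsilon> in at_right 0.
          ereal_of_enat (C_D_det P A x0 l0 \<epsilon>)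
            \<le> ereal (?CD B \<delta> * (n * (sqrt (L_ll P * LD P) / \<epsilon>) * ln (L_ll P * LD P / \<epsilon>)))))"
    using eventually_primal_complexity eventually_dual_complexity by (simp add: Let_def gap0_def)
qed

end
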